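(* Let $\mathbb{F}_q$ be a finite field with $q$ elements, let $k$ be a positive integer, and assume $p$ is an odd prime such that $\operatorname{ord}_p q=t>1$ and $p^m\,\|\,(q^t-1)$, where $m\ge 1$. Then the primitive idempotents of $\mathbb{F}_q[x]/\langle x^{p^k}-1\rangle$ are of the following forms: (1) $$e_0(x)=\frac{1}{p^k}\sum_{l=0}^{p^k-1}x^l.$$ (2) For each $0<j\le p^m-1$, $$e_j(x)=\frac{1}{p^k}\sum_{l=0}^{p^k-1}\sigma_1\bigl(\zeta_{p^m}^{-jl}\bigr)x^l,$$ where $e_i$ and $e_j$ are the same idempotent if and only if $i\equiv jq^u\pmod{p^m}$ for some $u\in\mathbb{Z}$, and, therefore, there are $\frac{p^m-1}{t}$ different primitive idempotents of this type. (3) For each $m<s\le k$ and $0<l<p^m$ such that $\gcd(l,p)=1$, $$e_{s,l}(x)=\frac{1}{p^{k+m-s}}\sum_{j=0}^{p^{k-s+m}-1}\sigma_1\bigl(\zeta_{p^m}^{-lj}\bigr)x^{p^{s-m}j},$$ where $e_{s,l_1}$ and $e_{s,l_2}$ are the same idempotent if and only if $l_1\equiv l_2q^u\pmod{p^m}$ for some $u\in\mathbb{N}$, and, therefore, for each fixed $s$, there are $\frac{\varphi(p^{k-s+m})}{t}$ different primitive idempotents of this type.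
   Context: The notation $p^m\,\|\,N$ means that $p^m\mid N$ and $p^{m+1}\nmid N$. $\operatorname{ord}_p q=\min\{r\ge 1: q^r\equiv 1\pmod p\}$ is the multiplicative order of $q$ modulo $p$ (in particular $\gcd(q,p)=1$). Since $p^m\mid q^t-1$, the field $\mathbb{F}_{q^t}$ contains a primitive $p^m$-th root of unity; $\zeta_{p^m}$ denotes a fixed one. The map $\sigma_1:\mathbb{F}_{q^t}\to\mathbb{F}_q$ is $\sigma_1(a)=a+\tau(a)+\tau^2(a)+\cdots+\tau^{t-1}(a)$, where $\tau$ is the Frobenius automorphism $a\mapsto a^q$ of $\mathbb{F}_{q^t}$ over $\mathbb{F}_q$. $\varphi$ is Euler's totient function. When $q$ is raised to a negative power modulo $p^m$, the inverse of $q$ modulo $p^m$ is meant. Elements of $\mathbb{F}_q[x]/\langle x^{p^k}-1\rangle$ are written as polynomials representing their classes.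
   Formalization: The count in (3) is corrected to φ(p^m)/t (the printed φ(p^{k-s+m})/t is false for s<k, e.g. q=2, p=3, k=3, s=2), and the claims in (2) are made only for m ≤ k (false for k<m, e.g. q=8, p=3, k=1). *)

theory Defs
  imports
    "HOL-Library.Cardinality"
    "HOL-Computational_Algebra.Polynomial"
    "HOL-Number_Theory.Number_Theory"
    "HOL-Algebra.QuotRing"
    "HOL-Algebra.Algebraic_Closure_Type"
begin

definition idempotent_elem :: "('a, 'b) ring_scheme \<Rightarrow> 'a \<Rightarrow> bool" where
  "idempotent_elem R e \<longleftrightarrow> e \<in> carrier R \<and> e \<otimes>\<^bsub>R\<^esub> e = e"

definition primitive_idempotent :: "('a, 'b) ring_scheme \<Rightarrow> 'a \<Rightarrow> bool" where
  "primitive_idempotent R e \<longleftrightarrow>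
     idempotent_elem R e \<and> e \<noteq> \<zero>\<^bsub>R\<^esub> \<and>
     \<not> (\<exists>f g. idempotent_elem R f \<and> idempotent_elem R g \<and>
             f \<noteq> \<zero>\<^bsub>R\<^esub> \<and> g \<noteq> \<zero>\<^bsub>R\<^esub> \<and>
             f \<otimes>\<^bsub>R\<^esub> g = \<zero>\<^bsub>R\<^esub> \<and> g \<otimes>\<^bsub>R\<^esub> f = \<zero>\<^bsub>R\<^esub> \<and> e = f \<oplus>\<^bsub>R\<^esub> g)"

definition cyc_ideal :: "nat \<Rightarrow> 'a::field poly set" where
  "cyc_ideal n = PIdl\<^bsub>ring_of_type_algebra\<^esub> (Polynomial.monom 1 n - 1)"

text \<open>The ring \<open>F[x] / \<langle>x^n - 1\<rangle>\<close>, with \<open>F\<close> the field type \<open>'a\<close>; its elements are cosets.\<close>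

definition cyc_ring :: "nat \<Rightarrow> 'a::field poly set ring" where
  "cyc_ring n = ring_of_type_algebra Quot cyc_ideal n"

definition cyc_class :: "nat \<Rightarrow> 'a::field poly \<Rightarrow> 'a poly set" where
  "cyc_class n f = cyc_ideal n +>\<^bsub>ring_of_type_algebra\<^esub> f"

definition primitive_root_of_unity :: "nat \<Rightarrow> 'a::field \<Rightarrow> bool" where
  "primitive_root_of_unity n z \<longleftrightarrow> z ^ n = 1 \<and> (\<forall>d. 0 < d \<and> d < n \<longrightarrow> z ^ d \<noteq> 1)"

definition frobenius :: "nat \<Rightarrow> 'b::field \<Rightarrow> 'b" where
  "frobenius q a = a ^ q"

text \<open>The field \<open>F_q\<close> is the type \<open>'a\<close> and its extension of degree \<open>t\<close> is the type \<open>'b\<close>, with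
  embedding \<open>\<iota>\<close>. The sum of conjugates is fixed by the Frobenius automorphism, hence lies in the
  image of \<open>\<iota>\<close>; \<open>sigma1\<close> is its unique preimage.\<close>

definition sigma1 :: "('a::{field,finite} \<Rightarrow> 'b::field) \<Rightarrow> nat \<Rightarrow> 'b \<Rightarrow> 'a" where
  "sigma1 \<iota> t a = (THE c. \<iota> c = (\<Sum>i=0..t-1. (frobenius CARD('a) ^^ i) a))"

text \<open>\<open>q^u\<close> modulo \<open>N\<close> for an integer exponent: negative powers are powers of the inverse of \<open>q\<close>
  modulo \<open>N\<close>.\<close>

definition int_power_mod :: "nat \<Rightarrow> nat \<Rightarrow> int \<Rightarrow> int" where
  "int_power_mod N q u =
     (if u \<ge> 0 then int q ^ nat u else modular_inverse (int N) (int q) ^ nat (- u))"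

definition e0 :: "nat \<Rightarrow> nat \<Rightarrow> 'a::field poly set" where
  "e0 p k = cyc_class (p ^ k)
     (Polynomial.smult (1 / of_nat (p ^ k)) (\<Sum>l=0..p^k-1. Polynomial.monom 1 l))"

text \<open>In \<open>e1\<close> the coefficients are periodic in \<open>l\<close> with period \<open>p^k\<close> only if \<open>m \<le> k\<close>, where \<open>\<zeta>\<close> has order
  \<open>p^m\<close>. For \<open>k < m\<close> the element \<open>e1\<close> need not be idempotent.\<close>

definition e1 ::
  "('a::{field,finite} \<Rightarrow> 'b::field) \<Rightarrow> nat \<Rightarrow> 'b \<Rightarrow> nat \<Rightarrow> nat \<Rightarrow> nat \<Rightarrow> 'a poly set" where
  "e1 \<iota> t \<zeta> p k j = cyc_class (p ^ k)
     (Polynomial.smult (1 / of_nat (p ^ k))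
       (\<Sum>l=0..p^k-1. Polynomial.monom (sigma1 \<iota> t (\<zeta> powi (- (int j * int l)))) l))"

definition e2 ::
  "('a::{field,finite} \<Rightarrow> 'b::field) \<Rightarrow> nat \<Rightarrow> 'b \<Rightarrow> nat \<Rightarrow> nat \<Rightarrow> nat \<Rightarrow> nat \<Rightarrow> nat \<Rightarrow> 'a poly set"
  where
  "e2 \<iota> t \<zeta> p k m s l = cyc_class (p ^ k)
     (Polynomial.smult (1 / of_nat (p ^ (k + m - s)))
       (\<Sum>j=0..p^(k-s+m)-1.
          Polynomial.monom (sigma1 \<iota> t (\<zeta> powi (- (int l * int j)))) (p ^ (s - m) * j)))"

end

theory Submission
  imports Defs
begin

text \<open>
  Let \<open>K\<close> be an algebraic closure of \<open>F_(q^t)\<close> and \<open>U\<close> the group of \<open>p^k\<close>-th roots of unity in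
  \<open>K\<close>. Since \<open>p\<close> does not divide \<open>q\<close>, the group \<open>U\<close> has \<open>p^k\<close> elements, so a class in
  \<open>F_q[x]/(x^(p^k) - 1)\<close> is determined by its values on \<open>U\<close>
  (\<open>cyc_class_eq_iff_ev\<close>). The class is idempotent iff all these values are \<open>0\<close> or \<open>1\<close>, and
  because the coefficients lie in \<open>F_q\<close>, the set where the value is \<open>1\<close> is closed under the Frobenius
  map \<open>x \<mapsto> x^q\<close>. Consequently an idempotent whose support is a single Frobenius orbit is primitive
  (\<open>primitive_idempotent_orbit_indicator\<close>), and a primitive idempotent whose support meets such an
  orbit is the indicator of that orbit (\<open>primitive_idempotent_eq_orbit_indicator\<close>). The theorem is
  thereby reduced to listing the Frobenius orbits on \<open>U\<close>.

  By orthogonality of characters, the class with coefficients \<open>\<sigma>\<^sub>1(w^(-l)) / N\<close> at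
  \<open>x^(r l)\<close>, with \<open>w^N = 1\<close>, takes at \<open>x\<close> the number of \<open>u < t\<close> with
  \<open>x^r = w^(q^u)\<close> (\<open>ev_trace_poly\<close>). For a nontrivial power \<open>w\<close> of \<open>\<zeta>\<close> these \<open>t\<close> conjugates are
  distinct, as \<open>q\<close> has order \<open>t\<close> already modulo \<open>p\<close>; so the number is \<open>0\<close> or \<open>1\<close>, and the support is
  the preimage of the orbit of \<open>w\<close> under \<open>x \<mapsto> x^r\<close>. Both families of the theorem have this shape:
  the first with \<open>r = 1\<close>, the second with \<open>r = p^(s - m)\<close>.

  The one arithmetical point is that for \<open>r = p^e\<close> and \<open>w\<close> of exact order \<open>p^m\<close> this preimage is
  again a single orbit (\<open>same_fibre_imp_mem_orb\<close>). The fibre over \<open>w\<close> has at most \<open>p^e\<close> elements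
  and is stable under \<open>x \<mapsto> x^(q^t)\<close>. As \<open>p\<close> is odd and \<open>p^m\<close> divides \<open>q^t - 1\<close> exactly, lifting the
  exponent shows that \<open>p^(m+e)\<close> divides \<open>(q^t)^d - 1\<close> only if \<open>p^e\<close> divides \<open>d\<close>
  (\<open>prime_power_dvd_power_minus_1_imp_dvd\<close>); so the orbit of any element of the fibre under this map
  already has \<open>p^e\<close> elements and fills the fibre.

  Every element of \<open>U\<close> other than \<open>1\<close> lies in one of these supports: if its order is at most \<open>p^m\<close>,
  it is itself a power of \<open>\<zeta>\<close>; if its order is \<open>p^s\<close> with \<open>s > m\<close>, its \<open>p^(s - m)\<close>-th power is
  a power of \<open>\<zeta>\<close> of exact order \<open>p^m\<close> (\<open>root_of_unity_cases\<close>). Two parameters give the same class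
  iff the corresponding powers of \<open>\<zeta>\<close> are conjugate, and each conjugacy class has \<open>t\<close> members, which
  gives the counts.
\<close>

section \<open>Finite fields inside a larger field\<close>

text \<open>Multiplication by a nonzero element permutes the nonzero elements, so it preserves their product.\<close>

lemma finite_field_power_card:
  fixes a :: "'a::{field,finite}"
  shows "a ^ CARD('a) = a"
proof (cases "a = 0")
  case False
  have "a ^ (CARD('a) - 1) * \<Prod>(UNIV - {0::'a}) = (\<Prod>y\<in>UNIV - {0}. a * y)"
    by (simp add: prod.distrib)
  also have "\<dots> = \<Prod>(UNIV - {0})"
    by (rule prod.reindex_bij_witness[of _ "\<lambda>y. y / a" "\<lambda>y. a * y"]) (use False in auto)
  finally have "a ^ (CARD('a) - 1) = 1"
    by simp
  then have "a * a ^ (CARD('a) - 1) = a" by simp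
  moreover have "CARD('a) = Suc (CARD('a) - 1)"
    using finite_UNIV_card_ge_0[where ?'a = 'a] by simp
  ultimately show ?thesis by (metis power_Suc)
qed (use finite_UNIV_card_ge_0[where ?'a = 'a] in auto)

lemma card_nth_roots_le:
  fixes a :: "'k::field"
  assumes "n > 0"
  shows "finite {x. x ^ n = a}" "card {x. x ^ n = a} \<le> n"
proof -
  let ?P = "Polynomial.monom 1 n - [:a:] :: 'k poly"
  have "Polynomial.coeff ?P n = 1"
    using assms by (cases n) auto
  then have nz: "?P \<noteq> 0" by (metis Polynomial.coeff_0 zero_neq_one)
  have *: "{x. x ^ n = a} = {x. poly ?P x = 0}"
    by (auto simp: poly_monom)
  show "finite {x. x ^ n = a}"
    unfolding * by (rule poly_roots_finite[OF nz])
  have "Polynomial.degree ?P \<le> n"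
    by (rule Polynomial.degree_diff_le) (auto simp: Polynomial.degree_monom_le)
  then show "card {x. x ^ n = a} \<le> n"
    unfolding * using card_poly_roots_bound[OF nz] by simp
qed

text \<open>Over \<open>'a\<close> the polynomial \<open>(X + 1)^q - X^q - 1\<close> has degree less than \<open>q\<close>, yet by
  \<open>a^q = a\<close> it vanishes at all \<open>q\<close> elements; so it is zero and its coefficients, the inner
  binomial coefficients, vanish in \<open>'a\<close>.\<close>

lemma of_nat_card_choose_eq_0:
  assumes "0 < i" "i < CARD('a)"
  shows "of_nat (CARD('a) choose i) = (0 :: 'a::{field,finite})"
proof -
  let ?q = "CARD('a)"
  let ?P = "\<Sum>j\<in>{0<..<?q}. Polynomial.monom (of_nat (?q choose j)) j :: 'a poly"
  have split: "{..?q} = insert 0 (insert ?q {0<..<?q})"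
    using assms by auto
  have "poly ?P a = 0" for a :: 'a
  proof -
    have "(a + 1) ^ ?q = (\<Sum>j\<le>?q. of_nat (?q choose j) * a ^ j)"
      by (simp add: binomial_ring)
    also have "\<dots> = 1 + (a ^ ?q + poly ?P a)"
      unfolding split using assms by (simp add: poly_sum poly_monom)
    finally show ?thesis
      by (simp add: finite_field_power_card)
  qed
  moreover have "Polynomial.degree ?P < ?q"
    by (rule Polynomial.degree_lessI) (use assms in \<open>auto simp: Polynomial.coeff_sum\<close>)
  ultimately have "?P = 0"
    using poly_eqI_degree[of UNIV ?P 0] assms by simp
  then have "Polynomial.coeff ?P i = 0" by simp
  then show ?thesis
    using assms by (simp add: Polynomial.coeff_sum)
qed

text \<open>The image of \<open>h\<close> is a copy of the finite field \<open>F_q\<close> in the field \<open>'k\<close>. Both the embedding into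
  \<open>F_(q^t)\<close> and the embedding into an algebraic closure are of this kind.\<close>

locale finite_subfield =
  fixes h :: "'a::{field,finite} \<Rightarrow> 'k::field"
  assumes h_one [simp]: "h 1 = 1"
    and h_add [simp]: "h (a + b) = h a + h b"
    and h_mult [simp]: "h (a * b) = h a * h b"
begin

lemma h_zero [simp]: "h 0 = 0"
proof -
  have "h 0 + h 0 = h 0 + 0"
    by (simp flip: h_add)
  then show ?thesis by (simp only: add_left_cancel)
qed

lemma h_minus [simp]: "h (- a) = - h a"
  using h_add[of a "- a"] by (simp add: add_eq_0_iff)

lemma h_diff [simp]: "h (a - b) = h a - h b"
  using h_add[of a "- b"] by simp

lemma h_eq_0_iff [simp]: "h a = 0 \<longleftrightarrow> a = 0"
proof
  show "a = 0" if "h a = 0"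
  proof (rule ccontr)
    assume "a \<noteq> 0"
    then have "h (a * inverse a) = 1" by (simp del: h_mult)
    with that show False by simp
  qed
qed simp

lemma h_eq_iff [simp]: "h a = h b \<longleftrightarrow> a = b"
  using h_eq_0_iff[of "a - b"] by simp

lemma h_power [simp]: "h (a ^ n) = h a ^ n"
  by (induction n) auto

lemma h_of_nat [simp]: "h (of_nat n) = of_nat n"
  by (induction n) auto

lemma h_inverse [simp]: "h (inverse a) = inverse (h a)"
proof (cases "a = 0")
  case False
  then have "h a * h (inverse a) = 1"
    by (simp flip: h_mult)
  then show ?thesis by (simp add: inverse_unique)
qed simp

lemma h_power_card: "h a ^ CARD('a) = h a"
  by (simp add: finite_field_power_card flip: h_power)

lemma h_power_card_power: "h a ^ (CARD('a) ^ u) = h a"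
  by (induction u) (simp_all add: h_power_card power_mult)

lemma frobenius_add: "(x + y :: 'k) ^ CARD('a) = x ^ CARD('a) + y ^ CARD('a)"
proof -
  let ?q = "CARD('a)"
  have q: "?q > 0" by (rule finite_UNIV_card_ge_0) simp
  then have split: "{..?q} = insert 0 (insert ?q {0<..<?q})" by auto
  have zero: "of_nat (?q choose i) = (0::'k)" if "i \<in> {0<..<?q}" for i
    using that of_nat_card_choose_eq_0[where ?'a = 'a, of i] h_of_nat[of "?q choose i"] by simp
  have "(x + y) ^ ?q = (\<Sum>i\<le>?q. of_nat (?q choose i) * x ^ i * y ^ (?q - i))"
    by (rule binomial_ring)
  also have "\<dots> = y ^ ?q + (x ^ ?q + (\<Sum>i\<in>{0<..<?q}. of_nat (?q choose i) * x ^ i * y ^ (?q - i)))"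
    unfolding split using q by simp
  also have "(\<Sum>i\<in>{0<..<?q}. of_nat (?q choose i) * x ^ i * y ^ (?q - i)) = 0"
    by (rule sum.neutral) (simp add: zero)
  finally show ?thesis by simp
qed

lemma frobenius_power_add:
  "(x + y :: 'k) ^ (CARD('a) ^ u) = x ^ (CARD('a) ^ u) + y ^ (CARD('a) ^ u)"
  by (induction u) (simp_all add: power_mult frobenius_add power_mult[of _ "CARD('a) ^ _"] mult.commute[of "CARD('a)"])

lemma frobenius_sum:
  "(\<Sum>x\<in>A. f x :: 'k) ^ CARD('a) = (\<Sum>x\<in>A. f x ^ CARD('a))"
  by (induction A rule: infinite_finite_induct) (simp_all add: frobenius_add)

text \<open>The equation \<open>x^q = x\<close> has at most \<open>q\<close> solutions, and the image of \<open>h\<close> already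
  provides \<open>q\<close> of them.\<close>

lemma range_h_eq_fixed_points: "range h = {x. x ^ CARD('a) = x}"
proof (rule card_subset_eq)
  let ?q = "CARD('a)"
  let ?P = "Polynomial.monom 1 ?q - Polynomial.monom 1 1 :: 'k poly"
  have q: "?q > 1"
    using card_mono[of UNIV "{0, 1::'a}"] by simp
  then have "Polynomial.coeff ?P ?q = 1" by simp
  then have nz: "?P \<noteq> 0" by (metis Polynomial.coeff_0 zero_neq_one)
  have *: "{x. x ^ ?q = x} = {x. poly ?P x = 0}"
    by (auto simp: poly_monom)
  show fin: "finite {x::'k. x ^ ?q = x}"
    unfolding * by (rule poly_roots_finite[OF nz])
  show sub: "range h \<subseteq> {x. x ^ ?q = x}"
    by (auto simp: h_power_card)
  have "Polynomial.degree ?P \<le> ?q"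
    using q by (intro Polynomial.degree_diff_le) (auto intro: order.trans[OF Polynomial.degree_monom_le])
  then have "card {x::'k. x ^ ?q = x} \<le> ?q"
    unfolding * using card_poly_roots_bound[OF nz] by simp
  moreover have "card (range h) = ?q"
    by (rule card_image) (auto simp: inj_on_def)
  ultimately show "card (range h) = card {x::'k. x ^ ?q = x}"
    using card_mono[OF fin sub] by simp
qed

text \<open>If the \<open>t\<close>-th power of the Frobenius map fixes \<open>a\<close>, then raising to the \<open>q\<close>-th power
  permutes the summands of the trace cyclically; so the trace is a fixed point and has a preimage.\<close>

lemma h_sigma1:
  assumes "t > 0" and a: "a ^ (CARD('a) ^ t) = a"
  shows "h (sigma1 h t a) = (\<Sum>i<t. a ^ (CARD('a) ^ i))"
proof -
  let ?q = "CARD('a)"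
  let ?T = "\<Sum>i<t. a ^ (?q ^ i)"
  have frob: "(frobenius ?q ^^ i) a = a ^ (?q ^ i)" for i
    by (induction i) (simp_all add: frobenius_def mult.commute flip: power_mult)
  have set: "{0..t-1} = {..<t}"
    using assms(1) by auto
  have "?T ^ ?q = (\<Sum>i<t. a ^ (?q ^ Suc i))"
    by (simp add: frobenius_sum mult.commute flip: power_mult)
  also have "\<dots> = ?T"
    using sum.lessThan_Suc_shift[of "\<lambda>i. a ^ (?q ^ i)" t] a by simp
  finally have "?T \<in> range h"
    unfolding range_h_eq_fixed_points by simp
  then obtain c where c: "h c = ?T" by auto
  then have "sigma1 h t a = c"
    unfolding sigma1_def frob set by (intro the_equality) (auto simp flip: c)
  with c show ?thesis by simp
qed

definition ev :: "'a poly \<Rightarrow> 'k \<Rightarrow> 'k" where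
  "ev f x = poly (map_poly h f) x"

lemma ev_0 [simp]: "ev 0 x = 0"
  by (simp add: ev_def)

lemma ev_pCons [simp]: "ev (pCons a f) x = h a + x * ev f x"
  by (simp add: ev_def map_poly_pCons)

lemma ev_1 [simp]: "ev 1 x = 1"
  by (simp add: ev_def)

lemma ev_add [simp]: "ev (f + g) x = ev f x + ev g x"
  by (induction f g rule: poly_induct2) (simp_all add: algebra_simps)

lemma ev_smult [simp]: "ev (Polynomial.smult c f) x = h c * ev f x"
  by (induction f) (simp_all add: algebra_simps)

lemma ev_minus [simp]: "ev (- f) x = - ev f x"
  by (induction f) simp_all

lemma ev_diff [simp]: "ev (f - g) x = ev f x - ev g x"
  using ev_add[of f "- g" x] by simp

lemma ev_mult [simp]: "ev (f * g) x = ev f x * ev g x"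
  by (induction f) (simp_all add: algebra_simps)

lemma ev_sum: "ev (sum f A) x = (\<Sum>i\<in>A. ev (f i) x)"
  by (induction A rule: infinite_finite_induct) simp_all

lemma ev_monom [simp]: "ev (Polynomial.monom c n) x = h c * x ^ n"
  by (simp add: ev_def map_poly_monom poly_monom)

text \<open>The coefficients are fixed by the Frobenius map, so evaluation commutes with it.\<close>

lemma ev_frobenius: "ev f (x ^ (CARD('a) ^ u)) = ev f x ^ (CARD('a) ^ u)"
proof (induction f)
  case (pCons a f)
  then show ?case
    by (simp add: frobenius_power_add h_power_card_power power_mult_distrib)
qed (simp add: power_0_left)

end

section \<open>The residue class ring modulo \<open>x^n - 1\<close>\<close>

lemma ideal_cyc_ideal: "ideal (cyc_ideal n :: 'a::field poly set) ring_of_type_algebra"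
  unfolding cyc_ideal_def
  by (rule cring.cgenideal_ideal[OF cring_from_type_algebra])
    (simp add: ring_of_type_algebra_def)

lemma mem_cyc_ideal_iff: "f \<in> cyc_ideal n \<longleftrightarrow> Polynomial.monom 1 n - 1 dvd f"
  by (auto simp: cyc_ideal_def cgenideal_def ring_of_type_algebra_def dvd_def mult.commute)

lemma cyc_class_eq_iff:
  "cyc_class n f = cyc_class n g \<longleftrightarrow> Polynomial.monom 1 n - 1 dvd f - g"
proof -
  let ?R = "ring_of_type_algebra :: 'a poly ring"
  interpret ring ?R by (rule ring_from_type_algebra)
  have "\<ominus>\<^bsub>?R\<^esub> g = - g"
    by (rule minus_equality) (simp_all add: ring_of_type_algebra_def)
  then have "f \<ominus>\<^bsub>?R\<^esub> g = f - g"
    by (simp add: a_minus_def) (simp add: ring_of_type_algebra_def)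
  then show ?thesis
    using quotient_eq_iff_same_a_r_cos[OF ideal_cyc_ideal, of f g n]
    by (simp add: cyc_class_def mem_cyc_ideal_iff) (simp add: ring_of_type_algebra_def)
qed

lemma carrier_cyc_ring: "carrier (cyc_ring n) = range (cyc_class n)"
  by (auto simp: cyc_ring_def FactRing_def A_RCOSETS_def' cyc_class_def ring_of_type_algebra_def)

lemma cyc_class_mult: "cyc_class n f \<otimes>\<^bsub>cyc_ring n\<^esub> cyc_class n g = cyc_class n (f * g)"
  and cyc_class_add: "cyc_class n f \<oplus>\<^bsub>cyc_ring n\<^esub> cyc_class n g = cyc_class n (f + g)"
  using ring_hom_mult[OF ideal.rcos_ring_hom[OF ideal_cyc_ideal], of f g n]
    ring_hom_add[OF ideal.rcos_ring_hom[OF ideal_cyc_ideal], of f g n]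
  by (simp_all add: cyc_class_def cyc_ring_def) (simp_all add: ring_of_type_algebra_def)

lemma zero_cyc_ring: "\<zero>\<^bsub>cyc_ring n\<^esub> = (cyc_class n 0 :: 'a::field poly set)"
proof -
  interpret ideal "cyc_ideal n :: 'a poly set" ring_of_type_algebra
    by (rule ideal_cyc_ideal)
  have "cyc_ideal n +>\<^bsub>ring_of_type_algebra\<^esub> (0::'a poly) = cyc_ideal n"
    using a_coset_add_zero[OF a_subset] by (simp add: ring_of_type_algebra_def)
  then show ?thesis
    by (simp add: cyc_ring_def FactRing_def cyc_class_def)
qed

section \<open>Idempotents as functions on the roots of unity\<close>

text \<open>The assumption on the number of roots says that \<open>x^n - 1\<close> splits into distinct linear factors
  over \<open>'k\<close>.\<close>

locale split_cyclic_ring = finite_subfield h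
  for h :: "'a::{field,finite} \<Rightarrow> 'k::field" +
  fixes n :: nat
  assumes n_pos: "n > 0"
    and card_roots: "card {x::'k. x ^ n = 1} = n"
begin

text \<open>A remainder modulo \<open>x^n - 1\<close> has degree less than \<open>n\<close>, so it is zero as soon as it vanishes at
  the \<open>n\<close> roots of unity.\<close>

lemma cyc_class_eq_iff_ev:
  "cyc_class n f = cyc_class n g \<longleftrightarrow> (\<forall>x. x ^ n = 1 \<longrightarrow> ev f x = ev g x)"
proof
  assume "cyc_class n f = cyc_class n g"
  then obtain d where d: "f - g = (Polynomial.monom 1 n - 1) * d"
    by (auto simp: cyc_class_eq_iff)
  show "\<forall>x. x ^ n = 1 \<longrightarrow> ev f x = ev g x"
  proof (intro allI impI)
    fix x :: 'k
    assume "x ^ n = 1"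
    then have "ev (f - g) x = 0"
      unfolding d by simp
    then show "ev f x = ev g x" by simp
  qed
next
  assume eq: "\<forall>x. x ^ n = 1 \<longrightarrow> ev f x = ev g x"
  let ?M = "Polynomial.monom 1 n - 1 :: 'a poly"
  define r where "r = (f - g) mod ?M"
  have M: "Polynomial.degree ?M = n" "?M \<noteq> 0"
  proof -
    have c: "Polynomial.coeff ?M n = 1"
      using n_pos by (simp flip: Polynomial.monom_0[of 1, unfolded one_pCons[symmetric]])
    then show "?M \<noteq> 0" by (metis Polynomial.coeff_0 zero_neq_one)
    have "Polynomial.degree ?M \<le> n"
      by (rule Polynomial.degree_diff_le) (simp_all add: Polynomial.degree_monom_le)
    moreover have "n \<le> Polynomial.degree ?M"
      by (rule Polynomial.le_degree) (subst c, simp)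
    ultimately show "Polynomial.degree ?M = n" by simp
  qed
  have r0: "ev r x = 0" if "x ^ n = 1" for x
  proof -
    have "ev (f - g) x = ev ((f - g) div ?M * ?M + r) x"
      unfolding r_def by (simp only: div_mult_mod_eq)
    then show ?thesis using that eq by simp
  qed
  have "r = 0 \<or> Polynomial.degree r < n"
    unfolding r_def using degree_mod_less[OF M(2), of "f - g"] M(1) by simp
  then have "Polynomial.degree (map_poly h r) < card {x::'k. x ^ n = 1}"
    using n_pos by (auto simp: card_roots intro: le_less_trans[OF map_poly_degree_leq])
  moreover have "Polynomial.degree (0 :: 'k poly) < card {x::'k. x ^ n = 1}"
    using n_pos by (simp add: card_roots)
  ultimately have "map_poly h r = 0"
    using r0 by (intro poly_eqI_degree[where A = "{x. x ^ n = 1}"]) (auto simp: ev_def)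
  then have "r = 0"
    by (subst (asm) map_poly_eq_0_iff) auto
  then show "cyc_class n f = cyc_class n g"
    by (simp add: cyc_class_eq_iff r_def mod_eq_0_iff_dvd)
qed

lemma cyc_class_eq_zero_iff:
  "cyc_class n f = \<zero>\<^bsub>cyc_ring n\<^esub> \<longleftrightarrow> (\<forall>x. x ^ n = 1 \<longrightarrow> ev f x = 0)"
  by (simp add: zero_cyc_ring cyc_class_eq_iff_ev)

lemma idempotent_cyc_class_iff:
  "idempotent_elem (cyc_ring n) (cyc_class n f) \<longleftrightarrow> (\<forall>x. x ^ n = 1 \<longrightarrow> ev f x \<in> {0, 1})"
  by (simp add: idempotent_elem_def carrier_cyc_ring rangeI cyc_class_mult cyc_class_eq_iff_ev)

definition support :: "'a poly \<Rightarrow> 'k set" where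
  "support f = {x. x ^ n = 1 \<and> ev f x \<noteq> 0}"

text \<open>Natural exponents suffice for an orbit: on roots of unity of order prime to \<open>q\<close> the Frobenius map
  is a permutation of finite order, so its inverse is one of its powers.\<close>

definition orb :: "'k \<Rightarrow> 'k set" where
  "orb x = range (\<lambda>u. x ^ (CARD('a) ^ u))"

text \<open>As \<open>support f\<close> is stable under the Frobenius map for every \<open>f\<close>, the last condition makes the
  support one whole orbit.\<close>

definition orbit_indicator :: "'a poly \<Rightarrow> bool" where
  "orbit_indicator f \<longleftrightarrow>
     (\<forall>x. x ^ n = 1 \<longrightarrow> ev f x \<in> {0, 1}) \<and> support f \<noteq> {} \<and>
     (\<forall>x\<in>support f. \<forall>y\<in>support f. y \<in> orb x)"

lemma orb_trans: "y \<in> orb x \<Longrightarrow> z \<in> orb y \<Longrightarrow> z \<in> orb x"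
  unfolding orb_def by (auto simp flip: power_mult power_add)

lemma orb_self: "x \<in> orb x"
  unfolding orb_def by (rule range_eqI[of _ _ 0]) simp

lemma orbit_indicator_cyc_class_eq_iff:
  assumes "orbit_indicator f" "orbit_indicator g"
  shows "cyc_class n f = cyc_class n g \<longleftrightarrow> support f = support g"
proof
  assume "cyc_class n f = cyc_class n g"
  then show "support f = support g"
    by (auto simp: cyc_class_eq_iff_ev support_def)
next
  assume eq: "support f = support g"
  show "cyc_class n f = cyc_class n g"
    unfolding cyc_class_eq_iff_ev
  proof (intro allI impI)
    fix x :: 'k
    assume x: "x ^ n = 1"
    then have "ev f x \<in> {0, 1}" "ev g x \<in> {0, 1}"
      using assms by (simp_all only: orbit_indicator_def)
    moreover have "ev f x \<noteq> 0 \<longleftrightarrow> ev g x \<noteq> 0"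
      using eq x by (auto simp: support_def)
    ultimately show "ev f x = ev g x" by auto
  qed
qed

lemma ev_eq_1_on_orb:
  assumes "ev f x = 1" "y \<in> orb x"
  shows "ev f y = 1"
  using assms by (auto simp: orb_def ev_frobenius)

text \<open>A decomposition into two nonzero orthogonal idempotents would split the support into two disjoint
  nonempty parts, each stable under the Frobenius map; a single orbit admits no such splitting.\<close>

lemma primitive_idempotent_orbit_indicator:
  assumes f: "orbit_indicator f"
  shows "primitive_idempotent (cyc_ring n) (cyc_class n f)"
  unfolding primitive_idempotent_def
proof (intro conjI notI)
  show "idempotent_elem (cyc_ring n) (cyc_class n f)"
    using f by (simp add: idempotent_cyc_class_iff orbit_indicator_def)
  show False if "cyc_class n f = \<zero>\<^bsub>cyc_ring n\<^esub>"
    using that f by (auto simp: cyc_class_eq_zero_iff orbit_indicator_def support_def)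
next
  assume "\<exists>a b. idempotent_elem (cyc_ring n) a \<and> idempotent_elem (cyc_ring n) b \<and>
    a \<noteq> \<zero>\<^bsub>cyc_ring n\<^esub> \<and> b \<noteq> \<zero>\<^bsub>cyc_ring n\<^esub> \<and> a \<otimes>\<^bsub>cyc_ring n\<^esub> b = \<zero>\<^bsub>cyc_ring n\<^esub> \<and>
    b \<otimes>\<^bsub>cyc_ring n\<^esub> a = \<zero>\<^bsub>cyc_ring n\<^esub> \<and> cyc_class n f = a \<oplus>\<^bsub>cyc_ring n\<^esub> b"
  then obtain a b where
    ab: "idempotent_elem (cyc_ring n) a" "idempotent_elem (cyc_ring n) b"
      "a \<noteq> \<zero>\<^bsub>cyc_ring n\<^esub>" "b \<noteq> \<zero>\<^bsub>cyc_ring n\<^esub>" "a \<otimes>\<^bsub>cyc_ring n\<^esub> b = \<zero>\<^bsub>cyc_ring n\<^esub>"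
      "cyc_class n f = a \<oplus>\<^bsub>cyc_ring n\<^esub> b"
    by blast
  from ab(1,2) obtain f1 f2 where
    f12: "a = cyc_class n f1" "b = cyc_class n f2"
    by (auto simp: idempotent_elem_def carrier_cyc_ring)
  have prod: "ev f1 x * ev f2 x = 0" and sum: "ev f x = ev f1 x + ev f2 x" if "x ^ n = 1" for x
    using ab(5,6) that by (simp_all add: f12 cyc_class_mult cyc_class_add cyc_class_eq_zero_iff
        cyc_class_eq_iff_ev)
  obtain x y where x: "x ^ n = 1" "ev f1 x = 1" and y: "y ^ n = 1" "ev f2 y = 1"
    using ab(1-4) by (auto simp: f12 idempotent_cyc_class_iff cyc_class_eq_zero_iff)
  have "x \<in> support f" "y \<in> support f"
    using x y prod[of x] prod[of y] sum[of x] sum[of y] by (auto simp: support_def)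
  then have "y \<in> orb x"
    using f by (simp add: orbit_indicator_def)
  then have "ev f1 y = 1"
    using x by (blast intro: ev_eq_1_on_orb)
  then show False
    using prod[of y] y by simp
qed

text \<open>The support of \<open>f\<close> contains the orbit of \<open>x\<close>, which is the support of \<open>g\<close>. So \<open>g\<close> and \<open>f - g\<close>
  are orthogonal idempotents with sum \<open>f\<close>, and primitivity of \<open>f\<close> leaves only \<open>f - g = 0\<close>.\<close>

lemma primitive_idempotent_eq_orbit_indicator:
  assumes f: "primitive_idempotent (cyc_ring n) (cyc_class n f)"
    and g: "orbit_indicator g" and x: "x \<in> support f" "x \<in> support g"
  shows "cyc_class n f = cyc_class n g"
proof (rule ccontr)
  assume neq: "cyc_class n f \<noteq> cyc_class n g"
  have val: "ev f y \<in> {0, 1}" "ev g y \<in> {0, 1}" if "y ^ n = 1" for y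
    using f g that by (auto simp: primitive_idempotent_def idempotent_cyc_class_iff orbit_indicator_def)
  have f1: "ev f y = 1" if "y \<in> support g" for y
  proof -
    have "y \<in> orb x" using g x that by (simp add: orbit_indicator_def)
    moreover have "ev f x = 1" using x val by (auto simp: support_def)
    ultimately show ?thesis by (blast intro: ev_eq_1_on_orb)
  qed
  have diff: "ev (f - g) y \<in> {0, 1}" "ev g y * ev (f - g) y = 0" if "y ^ n = 1" for y
    using val[OF that] f1[of y] that by (cases "ev g y = 0"; auto simp: support_def)+
  let ?R = "cyc_ring n :: 'a poly set ring"
  have indecomposable: False
    if "idempotent_elem ?R a" "idempotent_elem ?R b" "a \<noteq> \<zero>\<^bsub>?R\<^esub>" "b \<noteq> \<zero>\<^bsub>?R\<^esub>"
      "a \<otimes>\<^bsub>?R\<^esub> b = \<zero>\<^bsub>?R\<^esub>" "b \<otimes>\<^bsub>?R\<^esub> a = \<zero>\<^bsub>?R\<^esub>" "cyc_class n f = a \<oplus>\<^bsub>?R\<^esub> b" for a b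
  proof -
    have "\<exists>a b. idempotent_elem ?R a \<and> idempotent_elem ?R b \<and> a \<noteq> \<zero>\<^bsub>?R\<^esub> \<and> b \<noteq> \<zero>\<^bsub>?R\<^esub> \<and>
        a \<otimes>\<^bsub>?R\<^esub> b = \<zero>\<^bsub>?R\<^esub> \<and> b \<otimes>\<^bsub>?R\<^esub> a = \<zero>\<^bsub>?R\<^esub> \<and> cyc_class n f = a \<oplus>\<^bsub>?R\<^esub> b"
      by (intro exI conjI) (rule that)+
    with f show False
      unfolding primitive_idempotent_def by argo
  qed
  show False
  proof (rule indecomposable[of "cyc_class n g" "cyc_class n (f - g)"])
    show "idempotent_elem ?R (cyc_class n g)" "idempotent_elem ?R (cyc_class n (f - g))"
      using val diff by (simp_all only: idempotent_cyc_class_iff) auto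
    show "cyc_class n g \<noteq> \<zero>\<^bsub>?R\<^esub>" "cyc_class n (f - g) \<noteq> \<zero>\<^bsub>?R\<^esub>"
      using x neq by (auto simp: cyc_class_eq_zero_iff support_def cyc_class_eq_iff_ev)
    show prod: "cyc_class n g \<otimes>\<^bsub>?R\<^esub> cyc_class n (f - g) = \<zero>\<^bsub>?R\<^esub>"
      unfolding cyc_class_mult cyc_class_eq_zero_iff ev_mult using diff(2) by blast
    then show "cyc_class n (f - g) \<otimes>\<^bsub>?R\<^esub> cyc_class n g = \<zero>\<^bsub>?R\<^esub>"
      unfolding cyc_class_mult by (simp only: mult.commute)
    show "cyc_class n f = cyc_class n g \<oplus>\<^bsub>?R\<^esub> cyc_class n (f - g)"
      by (simp add: cyc_class_add)
  qed
qed

end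

section \<open>Orders of roots of unity\<close>

lemma power_gcd_eq_1:
  fixes x :: "'k::field"
  assumes "x ^ a = 1" "x ^ b = 1"
  shows "x ^ gcd a b = 1"
proof (cases "a = 0")
  case False
  then obtain c d where "a * c = b * d + gcd a b"
    using bezout_nat by blast
  then have "x ^ (a * c) = x ^ (b * d) * x ^ gcd a b"
    by (simp add: power_add)
  then show ?thesis
    using assms by (simp add: power_mult)
qed (use assms in simp)

text \<open>The hypotheses say that \<open>x\<close> has exact order \<open>p^s\<close>: a divisor of \<open>p^s\<close> that does not divide
  \<open>p^(s-1)\<close> is \<open>p^s\<close> itself.\<close>

lemma prime_power_order_dvd:
  fixes x :: "'k::field"
  assumes p: "Factorial_Ring.prime (p::nat)" and "x ^ (p ^ s) = 1" "s > 0" "x ^ (p ^ (s - 1)) \<noteq> 1"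
    and d: "x ^ d = 1"
  shows "p ^ s dvd d"
proof -
  have "gcd d (p ^ s) dvd p ^ s" by simp
  then obtain i where i: "i \<le> s" "gcd d (p ^ s) = p ^ i"
    using divides_primepow_nat[OF p] by blast
  have "x ^ (p ^ i) = 1"
    using power_gcd_eq_1[OF d assms(2)] i by simp
  have "i = s"
  proof (rule ccontr)
    assume "i \<noteq> s"
    then have "p ^ i dvd p ^ (s - 1)"
      using i by (intro le_imp_power_dvd) simp
    then obtain c where "p ^ (s - 1) = p ^ i * c" ..
    with \<open>x ^ (p ^ i) = 1\<close> have "x ^ (p ^ (s - 1)) = 1" by (simp add: power_mult)
    with assms(4) show False ..
  qed
  with i show ?thesis by (metis gcd_dvd1)
qed

lemma primitive_root_of_unity_power_eq_1_iff:
  assumes "primitive_root_of_unity N z" "N > 0"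
  shows "z ^ d = 1 \<longleftrightarrow> N dvd d"
proof -
  have "z ^ d = z ^ (N * (d div N) + d mod N)" by simp
  also have "\<dots> = z ^ (d mod N)"
    using assms by (simp only: power_add power_mult) (simp add: primitive_root_of_unity_def)
  finally show ?thesis
    using assms unfolding primitive_root_of_unity_def
    by (metis bot_nat_0.not_eq_extremum dvd_eq_mod_eq_0 mod_less_divisor power_0)
qed

lemma power_eq_if_cong:
  fixes x :: "'k::monoid_mult"
  assumes "x ^ N = 1" "[a = b] (mod N)"
  shows "x ^ a = x ^ b"
proof -
  have "x ^ c = x ^ (c mod N)" for c
    using assms(1) by (metis mult_div_mod_eq power_add power_mult power_one mult_1)
  from this[of a] this[of b] show ?thesis
    using assms(2) by (simp add: cong_def)
qed

lemma power_diff_eq_1: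
  fixes x :: "'k::field"
  assumes "x \<noteq> 0" "x ^ i = x ^ j" "i \<le> j"
  shows "x ^ (j - i) = 1"
  using assms by (simp add: power_diff)

lemma iterated_power_eq_imp_power_eq_1:
  fixes x :: "'k::field"
  assumes "x \<noteq> 0" "x ^ (a ^ v) = x ^ (a ^ w)" "v \<le> w" "a > 0"
  shows "x ^ (a ^ v * (a ^ (w - v) - 1)) = 1"
proof -
  have "a ^ w - a ^ v = a ^ v * (a ^ (w - v) - 1)"
    using assms(3) by (simp add: diff_mult_distrib2 flip: power_add)
  then show ?thesis
    using power_diff_eq_1[OF assms(1,2)] assms(3,4) by (simp add: power_increasing)
qed

lemma atLeast0AtMost_pred: "0 < N \<Longrightarrow> {0..N - 1} = {..<N}" for N :: nat
  by auto

lemma sum_powers_root_of_unity: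
  fixes y :: "'k::field"
  assumes "y ^ N = 1"
  shows "(\<Sum>l<N. y ^ l) = (if y = 1 then of_nat N else 0)"
  using power_diff_1_eq[of y N] assms by auto

section \<open>Lifting the exponent\<close>

lemma cong_one_plus_multiple:
  fixes Q :: int
  assumes "P dvd Q - 1"
  shows "[Q ^ i = 1 + int i * (Q - 1)] (mod P\<^sup>2)"
proof (induction i)
  case (Suc i)
  have "[Q ^ i * Q = (1 + int i * (Q - 1)) * Q] (mod P\<^sup>2)"
    by (rule cong_mult[OF Suc]) simp
  also have "(1 + int i * (Q - 1)) * Q = 1 + int (Suc i) * (Q - 1) + int i * (Q - 1)\<^sup>2"
    by (simp add: algebra_simps power2_eq_square)
  also have "[\<dots> = 1 + int (Suc i) * (Q - 1) + 0] (mod P\<^sup>2)"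
    using assms by (intro cong_add cong_refl) (auto simp: cong_0_iff intro: dvd_mult dvd_power_same)
  finally show ?case by (simp add: mult.commute)
qed simp

text \<open>The quotient \<open>(Q^p - 1) / (Q - 1)\<close> is \<open>1 + Q + \<dots> + Q^(p-1)\<close>. To first order in \<open>Q - 1\<close> it equals
  \<open>p + (Q - 1) p (p - 1) / 2\<close>; as \<open>p\<close> is odd and divides \<open>Q - 1\<close>, this is \<open>p\<close>
  modulo \<open>p^2\<close>. So raising to the \<open>p\<close>-th power
  gains exactly one factor \<open>p\<close>.\<close>

lemma prime_power_exactly_dvd_power_prime:
  fixes Q :: int
  assumes p: "Factorial_Ring.prime p" "odd p" and m: "m \<ge> 1"
    and Q: "int p ^ m dvd Q - 1" "\<not> int p ^ (m + 1) dvd Q - 1"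
  shows "int p ^ (m + 1) dvd Q ^ p - 1 \<and> \<not> int p ^ (m + 2) dvd Q ^ p - 1"
proof -
  let ?P = "int p" and ?S = "\<Sum>i<p. Q ^ i"
  have P: "Factorial_Ring.prime ?P" "?P > 0" using p by (auto simp: prime_gt_0_nat)
  have PQ: "?P dvd Q - 1"
    using Q(1) m by (meson dvd_power dvd_trans less_le_trans zero_less_one)
  \<comment> \<open>With \<open>c = (p - 1) / 2\<close> the sum of the indices is \<open>p c\<close>, a multiple of \<open>p\<close>.\<close>
  from p obtain c where c: "p = 2 * c + 1" by (auto elim: oddE)
  have "(\<Sum>i<p. int i) = ?P * int c"
    unfolding c by (induction c) (simp_all add: algebra_simps)
  have "[?S = (\<Sum>i<p. 1 + int i * (Q - 1))] (mod ?P\<^sup>2)"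
    by (intro cong_sum cong_one_plus_multiple PQ)
  also have "(\<Sum>i<p. 1 + int i * (Q - 1)) = ?P + (?P * (Q - 1)) * int c"
    using \<open>(\<Sum>i<p. int i) = _\<close>
    by (simp add: sum.distrib flip: sum_distrib_right)
  also have "[\<dots> = ?P + 0] (mod ?P\<^sup>2)"
    using PQ by (intro cong_add cong_refl) (simp add: cong_0_iff power2_eq_square)
  finally have S: "[?S = ?P] (mod ?P\<^sup>2)" by simp
  then have "?P\<^sup>2 dvd ?S - ?P" by (simp add: cong_iff_dvd_diff)
  then obtain d where "?S - ?P = ?P\<^sup>2 * d" ..
  then have u: "?S = ?P * (1 + ?P * d)" by (simp add: algebra_simps power2_eq_square)
  have "\<not> ?P dvd 1 + ?P * d"
  proof
    assume "?P dvd 1 + ?P * d"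
    then have "?P dvd 1" by (metis dvd_add_times_triv_right_iff mult.commute)
    with P show False by (simp add: not_prime_unit)
  qed
  then have cop: "coprime (?P ^ (m + 1)) (1 + ?P * d)"
    using P(1) by (simp add: prime_imp_coprime)
  have eq: "Q ^ p - 1 = ?P * ((Q - 1) * (1 + ?P * d))"
    unfolding power_diff_1_eq[of Q p] u by (simp add: algebra_simps)
  have "?P ^ (m + 1) dvd Q ^ p - 1"
    unfolding eq using Q(1) by (simp add: dvd_mult2)
  moreover have "\<not> ?P ^ (m + 2) dvd Q ^ p - 1"
    unfolding eq using Q(2) P(2) cop by (simp add: coprime_dvd_mult_left_iff)
  ultimately show ?thesis by simp
qed

text \<open>A surplus factor \<open>p\<close> in \<open>Q^d - 1\<close> must divide \<open>1 + Q + \<dots> + Q^(d-1)\<close>, which is \<open>d\<close> modulo \<open>p\<close>.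
  Writing \<open>d = p d'\<close>, the induction continues with \<open>Q^p\<close> and \<open>m + 1\<close> in place of \<open>Q\<close> and \<open>m\<close>.\<close>

lemma prime_power_dvd_power_minus_1_imp_dvd_int:
  fixes Q :: int
  assumes "Factorial_Ring.prime p" "odd p" "m \<ge> 1"
    and "int p ^ m dvd Q - 1" "\<not> int p ^ (m + 1) dvd Q - 1"
    and "int p ^ (m + r) dvd Q ^ d - 1"
  shows "p ^ r dvd d"
  using assms(3-)
proof (induction r arbitrary: m Q d)
  case (Suc r)
  let ?P = "int p"
  have P: "Factorial_Ring.prime ?P" "?P > 0" using assms(1) by (auto simp: prime_gt_0_nat)
  have PQ: "?P dvd Q - 1"
    using Suc.prems(1,2) by (meson dvd_power dvd_trans less_le_trans zero_less_one)
  have "?P dvd (\<Sum>i<d. Q ^ i)"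
  proof (rule ccontr)
    assume "\<not> ?P dvd (\<Sum>i<d. Q ^ i)"
    then have "coprime (?P ^ (m + 1)) (\<Sum>i<d. Q ^ i)"
      using P(1) by (simp add: prime_imp_coprime)
    moreover have "?P ^ (m + 1) dvd (Q - 1) * (\<Sum>i<d. Q ^ i)"
      using dvd_trans[OF le_imp_power_dvd Suc.prems(4), of "m + 1"]
      by (simp flip: power_diff_1_eq)
    ultimately show False
      using Suc.prems(3) by (simp only: coprime_dvd_mult_left_iff)
  qed
  moreover have "[(\<Sum>i<d. Q ^ i) = (\<Sum>i<d. 1 ^ i)] (mod ?P)"
    using PQ by (intro cong_sum cong_pow) (simp add: cong_iff_dvd_diff)
  ultimately have "?P dvd int d"
    using cong_dvd_iff[of "\<Sum>i<d. Q ^ i" "int d" ?P] by simp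
  then obtain d' where d': "d = p * d'" by auto
  have "p ^ r dvd d'"
    using prime_power_exactly_dvd_power_prime[OF assms(1,2) Suc.prems(1-3)] Suc.prems(4)
    by (intro Suc.IH[of "m + 1" "Q ^ p"]) (simp_all add: d' power_mult)
  then show ?case by (simp add: d')
qed simp

lemma prime_power_dvd_power_minus_1_imp_dvd:
  fixes Q :: nat
  assumes "Factorial_Ring.prime p" "odd p" "m \<ge> 1" "Q > 0"
    and "p ^ m dvd Q - 1" "\<not> p ^ (m + 1) dvd Q - 1"
    and "p ^ (m + r) dvd Q ^ d - 1"
  shows "p ^ r dvd d"
proof -
  have dvd_iff: "int p ^ j dvd int Q ^ i - 1 \<longleftrightarrow> p ^ j dvd Q ^ i - 1" for i j
  proof -
    have "int Q ^ i - 1 = int (Q ^ i - 1)"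
      using assms(4) by (simp add: of_nat_diff)
    then show ?thesis
      by (simp only: of_nat_dvd_iff flip: of_nat_power)
  qed
  show ?thesis
    using assms(5-) dvd_iff[of _ 1]
    by (intro prime_power_dvd_power_minus_1_imp_dvd_int[OF assms(1-3), of "int Q" r d])
      (simp_all only: dvd_iff power_one_right not_False_eq_True)
qed

section \<open>Frobenius orbits on roots of unity of prime power order\<close>

locale cyclic_prime_power_length =
  fixes \<iota> :: "'a::{field,finite} \<Rightarrow> 'b::{field,finite}"
    and \<zeta> :: 'b
    and q k p t m :: nat
  assumes q_def: "q = CARD('a)"
    and k_pos: "k > 0"
    and prime_p: "Factorial_Ring.prime p" and odd_p: "odd p"
    and ord_q: "ord p q = t" and t_gt_1: "t > 1"
    and m_ge_1: "m \<ge> 1" and pm_dvd: "p ^ m dvd q ^ t - 1" and not_dvd: "\<not> p ^ (m + 1) dvd q ^ t - 1"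
    and card_b: "CARD('b) = q ^ t"
    and iota_hom: "\<iota> \<in> ring_hom ring_of_type_algebra ring_of_type_algebra"
    and zeta: "primitive_root_of_unity (p ^ m) \<zeta>"
begin

text \<open>The inclusion of \<open>F_q\<close> in \<open>F_(q^t)\<close> determines the trace \<open>\<sigma>\<^sub>1\<close>; the inclusion in the algebraic
  closure makes it possible to evaluate at all \<open>p^k\<close>-th roots of unity, also for \<open>k > m\<close>.\<close>

sublocale iota: finite_subfield \<iota>
  using ring_hom_one[OF iota_hom] ring_hom_add[OF iota_hom] ring_hom_mult[OF iota_hom]
  by unfold_locales (simp_all add: ring_of_type_algebra_def)

abbreviation emb :: "'a \<Rightarrow> 'b alg_closure" where
  "emb a \<equiv> to_ac (\<iota> a)"

sublocale finite_subfield emb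
  by unfold_locales simp_all

abbreviation Z :: "'b alg_closure" where
  "Z \<equiv> to_ac \<zeta>"

lemma p_pos: "p > 0" and q_pos: "q > 0" and t_pos: "t > 0"
  using prime_p t_gt_1 by (auto simp: prime_gt_0_nat q_def intro: finite_UNIV_card_ge_0)

lemma coprime_p_q: "coprime p q"
  using ord_q t_gt_1 ord_eq_0[of p q] by simp

lemma not_p_dvd_q: "\<not> p dvd q"
  using coprime_p_q prime_p by (metis coprime_absorb_left not_prime_unit)

lemma of_nat_p_neq_0: "(of_nat p :: 'a) \<noteq> 0"
proof
  assume "(of_nat p :: 'a) = 0"
  then have "CHAR('a) dvd p" by (simp add: of_nat_eq_0_iff_char_dvd)
  moreover have "CHAR('a) \<noteq> 1" by (metis of_nat_CHAR of_nat_1 one_neq_zero)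
  ultimately have "CHAR('a) = p" using prime_p unfolding prime_nat_iff by blast
  then show False using CHAR_dvd_CARD[where ?'a = 'a] not_p_dvd_q by (simp add: q_def)
qed

lemma p_dvd_power_minus_1_iff: "p dvd q ^ d - 1 \<longleftrightarrow> t dvd d"
  using ord_divides[of q d p] q_pos by (simp add: ord_q cong_altdef_nat)

lemma cong_power_t: "[q ^ (t * v) = 1] (mod p ^ m)"
proof -
  have "[q ^ t = 1] (mod p ^ m)"
    using pm_dvd q_pos by (simp add: cong_altdef_nat)
  from cong_pow[OF this, of v] show ?thesis by (simp add: power_mult)
qed

lemma frobenius_period: "x ^ (p ^ m) = 1 \<Longrightarrow> x ^ (q ^ (t * v)) = x" for x :: "'c::monoid_mult"
  using power_eq_if_cong[OF _ cong_power_t] by fastforce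

text \<open>As \<open>t\<close> is the order of \<open>q\<close> already modulo \<open>p\<close>, the number \<open>q^d - 1\<close> is prime to \<open>p\<close> for
  \<open>0 < d < t\<close>; so \<open>x^(q^d) = x\<close> forces \<open>x = 1\<close>.\<close>

lemma frobenius_inj:
  fixes x :: "'c::field"
  assumes "x ^ (p ^ m) = 1" "x \<noteq> 1"
  shows "inj_on (\<lambda>u. x ^ (q ^ u)) {..<t}"
proof (rule linorder_inj_onI)
  fix u v
  assume uv: "u < v" "u \<in> {..<t}" "v \<in> {..<t}"
  show "x ^ (q ^ u) \<noteq> x ^ (q ^ v)"
  proof
    assume eq: "x ^ (q ^ u) = x ^ (q ^ v)"
    have "x \<noteq> 0" using assms(1) p_pos by (auto simp: power_0_left)
    then have "x ^ (q ^ u * (q ^ (v - u) - 1)) = 1"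
      using eq uv q_pos by (intro iterated_power_eq_imp_power_eq_1) auto
    then have "x ^ gcd (p ^ m) (q ^ u * (q ^ (v - u) - 1)) = 1"
      by (rule power_gcd_eq_1[OF assms(1)])
    have "\<not> p dvd q ^ u"
      using not_p_dvd_q prime_p prime_dvd_power by blast
    moreover have "\<not> p dvd q ^ (v - u) - 1"
      using uv unfolding p_dvd_power_minus_1_iff by (auto dest: dvd_imp_le)
    ultimately have "coprime (p ^ m) (q ^ u * (q ^ (v - u) - 1))"
      using prime_p by (metis coprime_mult_right_iff coprime_power_left_iff prime_imp_coprime)
    then show False
      using assms(2) \<open>x ^ gcd _ _ = 1\<close> by (simp only: coprime_iff_gcd_eq_1 power_one_right)
  qed
qed auto

lemma Z_power_eq_1_iff: "Z ^ d = 1 \<longleftrightarrow> p ^ m dvd d"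
  using primitive_root_of_unity_power_eq_1_iff[OF zeta, of d] p_pos
  by (simp flip: to_ac_power)

lemma Z_power_power: "(Z ^ l) ^ (p ^ m) = 1"
  by (simp add: Z_power_eq_1_iff flip: power_mult)

lemma Z_power_eq_iff: "Z ^ i = Z ^ j \<longleftrightarrow> [i = j] (mod p ^ m)"
proof
  show "[i = j] (mod p ^ m)" if "Z ^ i = Z ^ j"
    using that
  proof (induction i j rule: linorder_wlog)
    case (le i j)
    have "Z \<noteq> 0"
      using Z_power_power[of 1] p_pos by (auto simp: power_0_left)
    then have "Z ^ (j - i) = 1"
      using le by (intro power_diff_eq_1)
    then have "p ^ m dvd j - i" by (simp add: Z_power_eq_1_iff)
    then show ?case using le by (metis cong_altdef_nat cong_sym)
  next
    case (sym i j)
    then show ?case by (metis cong_sym)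
  qed
qed (use power_eq_if_cong[of Z "p ^ m"] Z_power_power[of 1] in simp)

lemma roots_of_unity_eq_powers:
  assumes "x ^ (p ^ m) = 1"
  obtains j where "j < p ^ m" "x = Z ^ j"
proof -
  have inj: "inj_on (\<lambda>j. Z ^ j) {..<p ^ m}"
    by (auto simp: inj_on_def Z_power_eq_iff cong_less_modulus_unique_nat)
  have "(\<lambda>j. Z ^ j) ` {..<p ^ m} = {x. x ^ (p ^ m) = 1}"
  proof (rule card_seteq)
    show "card {x::'b alg_closure. x ^ (p ^ m) = 1} \<le> card ((\<lambda>j. Z ^ j) ` {..<p ^ m})"
      using card_nth_roots_le(2)[of "p ^ m" 1] p_pos by (simp add: card_image[OF inj])
  qed (use card_nth_roots_le(1)[of "p ^ m" 1] p_pos Z_power_power in auto)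
  with assms that show thesis by blast
qed

text \<open>Extracting a \<open>p^k\<close>-th root of \<open>\<zeta>\<close> gives an element of order \<open>p^(m+k)\<close>, whose powers contain
  all \<open>p^k\<close>-th roots of unity.\<close>

lemma card_roots_of_unity: "card {x::'b alg_closure. x ^ (p ^ k) = 1} = p ^ k"
proof (rule antisym)
  show "card {x::'b alg_closure. x ^ (p ^ k) = 1} \<le> p ^ k"
    using p_pos by (intro card_nth_roots_le) simp
  obtain b where b: "b ^ (p ^ k) = Z"
    using nth_root_exists[of "p ^ k" Z] p_pos by auto
  have one: "b ^ (p ^ (m + k)) = 1"
    using Z_power_power[of 1] b by (simp add: power_add power_mult mult.commute)
  have "m + k - 1 = k + (m - 1)" using m_ge_1 by simp
  then have "b ^ (p ^ (m + k - 1)) = Z ^ (p ^ (m - 1))"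
    by (simp add: power_add power_mult b)
  also have "\<dots> \<noteq> 1"
    using m_ge_1 p_pos prime_gt_1_nat[OF prime_p]
    by (auto simp: Z_power_eq_1_iff dest!: dvd_imp_le power_le_imp_le_exp[rotated])
  finally have order: "p ^ (m + k) dvd d" if "b ^ d = 1" for d
    using prime_power_order_dvd[OF prime_p one _ _ that] k_pos by simp
  have "b \<noteq> 0" using one p_pos by (auto simp: power_0_left)
  have inj: "inj_on (\<lambda>i. b ^ (p ^ m * i)) {..<p ^ k}"
  proof (rule linorder_inj_onI)
    fix i j
    assume ij: "i < j" "i \<in> {..<p ^ k}" "j \<in> {..<p ^ k}"
    show "b ^ (p ^ m * i) \<noteq> b ^ (p ^ m * j)"
    proof
      assume "b ^ (p ^ m * i) = b ^ (p ^ m * j)"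
      then have "b ^ (p ^ m * (j - i)) = 1"
        using power_diff_eq_1[OF \<open>b \<noteq> 0\<close>] ij by (simp add: diff_mult_distrib2)
      then have "p ^ m * p ^ k dvd p ^ m * (j - i)"
        using order by (simp flip: power_add)
      then have "p ^ k dvd j - i" using p_pos by simp
      with ij show False by (auto dest: dvd_imp_le)
    qed
  qed auto
  have "b ^ (p ^ m * i * p ^ k) = 1" for i
  proof -
    have "p ^ m * i * p ^ k = p ^ (m + k) * i" by (simp add: power_add)
    then show ?thesis using one by (simp only: power_mult power_one)
  qed
  then have "(\<lambda>i. b ^ (p ^ m * i)) ` {..<p ^ k} \<subseteq> {x. x ^ (p ^ k) = 1}"
    by (auto simp flip: power_mult)
  then have "card ((\<lambda>i. b ^ (p ^ m * i)) ` {..<p ^ k}) \<le> card {x::'b alg_closure. x ^ (p ^ k) = 1}"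
    using p_pos by (intro card_mono card_nth_roots_le) simp_all
  then show "p ^ k \<le> card {x::'b alg_closure. x ^ (p ^ k) = 1}"
    by (simp add: card_image[OF inj])
qed

sublocale split_cyclic_ring emb "p ^ k"
  using p_pos card_roots_of_unity by unfold_locales simp_all

lemma orb_eq_image:
  assumes "x ^ (p ^ m) = 1"
  shows "orb x = (\<lambda>u. x ^ (q ^ u)) ` {..<t}"
proof -
  have "x ^ (q ^ u) = x ^ (q ^ (u mod t))" for u
  proof -
    have "x ^ (q ^ u) = x ^ (q ^ (t * (u div t) + u mod t))" by simp
    also have "\<dots> = x ^ (q ^ (u mod t))"
      by (simp only: power_add power_mult[of x "q ^ (t * _)"] frobenius_period[OF assms])
    finally show ?thesis .
  qed
  then show ?thesis
    unfolding orb_def q_def[symmetric] using t_pos by fastforce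
qed

lemma card_orb:
  assumes "x ^ (p ^ m) = 1" "x \<noteq> 1"
  shows "card (orb x) = t"
  unfolding orb_eq_image[OF assms(1)] by (simp add: card_image frobenius_inj[OF assms])

text \<open>The Frobenius map has finite order on \<open>p^m\<close>-th roots of unity, so it can be undone by going on.\<close>

lemma orb_sym:
  assumes "x ^ (p ^ m) = 1" "y \<in> orb x"
  shows "x \<in> orb y"
proof -
  obtain u where u: "y = x ^ (q ^ u)"
    using assms(2) by (auto simp: orb_def q_def)
  have "u + (t * u - u) = t * u" using t_pos by simp
  then have "q ^ u * q ^ (t * u - u) = q ^ (t * u)"
    by (simp only: flip: power_add)
  then have "y ^ (q ^ (t * u - u)) = x ^ (q ^ (t * u))"
    by (simp only: u flip: power_mult)
  then show ?thesis
    unfolding orb_def q_def[symmetric] frobenius_period[OF assms(1)]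
    by (metis rangeI)
qed

text \<open>Iterating the \<open>q^t\<close>-th power from \<open>a\<close> stays in the fibre over \<open>y\<close>, and by lifting the exponent
  the first \<open>p^e\<close> iterates are distinct; the fibre has no room for further elements.\<close>

lemma same_fibre_imp_mem_orb:
  assumes y: "y ^ (p ^ m) = 1" "y ^ (p ^ (m - 1)) \<noteq> 1"
    and a: "a ^ (p ^ e) = y" and b: "b ^ (p ^ e) = y"
  shows "b \<in> orb a"
proof -
  define Q where "Q = q ^ t"
  have Q: "Q > 0" using q_pos by (simp add: Q_def)
  have one: "a ^ (p ^ (m + e)) = 1"
    using y(1) a by (simp add: power_add power_mult mult.commute)
  have "m + e - 1 = e + (m - 1)" using m_ge_1 by simp
  then have "a ^ (p ^ (m + e - 1)) \<noteq> 1"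
    using y(2) by (simp add: power_add power_mult a)
  then have order: "p ^ (m + e) dvd d" if "a ^ d = 1" for d
    using prime_power_order_dvd[OF prime_p one _ _ that] m_ge_1 by simp
  have "a \<noteq> 0" using one p_pos by (auto simp: power_0_left)
  have inj: "inj_on (\<lambda>v. a ^ (Q ^ v)) {..<p ^ e}"
  proof (rule linorder_inj_onI)
    fix v w
    assume vw: "v < w" "v \<in> {..<p ^ e}" "w \<in> {..<p ^ e}"
    show "a ^ (Q ^ v) \<noteq> a ^ (Q ^ w)"
    proof
      assume "a ^ (Q ^ v) = a ^ (Q ^ w)"
      then have "a ^ (Q ^ v * (Q ^ (w - v) - 1)) = 1"
        using \<open>a \<noteq> 0\<close> vw Q by (intro iterated_power_eq_imp_power_eq_1) auto
      then have "p ^ (m + e) dvd Q ^ v * (Q ^ (w - v) - 1)" by (rule order)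
      moreover have "coprime (p ^ (m + e)) (Q ^ v)"
        using coprime_p_q by (simp add: Q_def)
      ultimately have "p ^ (m + e) dvd Q ^ (w - v) - 1"
        by (simp only: coprime_dvd_mult_right_iff)
      then have "p ^ e dvd w - v"
        by (rule prime_power_dvd_power_minus_1_imp_dvd[OF prime_p odd_p m_ge_1 Q
            pm_dvd[folded Q_def] not_dvd[folded Q_def]])
      with vw show False by (auto dest: dvd_imp_le)
    qed
  qed auto
  have "(\<lambda>v. a ^ (Q ^ v)) ` {..<p ^ e} = {x. x ^ (p ^ e) = y}"
  proof (rule card_seteq)
    show "card {x. x ^ (p ^ e) = y} \<le> card ((\<lambda>v. a ^ (Q ^ v)) ` {..<p ^ e})"
      using p_pos by (simp add: card_image[OF inj] card_nth_roots_le)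
    have "(a ^ (Q ^ v)) ^ (p ^ e) = y" for v
    proof -
      have "(a ^ (Q ^ v)) ^ (p ^ e) = (a ^ (p ^ e)) ^ (Q ^ v)"
        by (simp only: mult.commute flip: power_mult)
      also have "\<dots> = y"
        by (simp only: a Q_def frobenius_period[OF y(1)] flip: power_mult[of q t v])
      finally show ?thesis .
    qed
    then show "(\<lambda>v. a ^ (Q ^ v)) ` {..<p ^ e} \<subseteq> {x. x ^ (p ^ e) = y}" by auto
  qed (use p_pos in \<open>simp add: card_nth_roots_le\<close>)
  with b obtain v where "b = a ^ (q ^ (t * v))"
    by (auto simp: Q_def power_mult)
  then show ?thesis by (auto simp: orb_def q_def)
qed

section \<open>Trace polynomials as orbit indicators\<close>

text \<open>The common shape of both families of the classification.\<close>

definition trace_poly :: "nat \<Rightarrow> nat \<Rightarrow> 'b \<Rightarrow> 'a poly" where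
  "trace_poly N r w = Polynomial.smult (1 / of_nat N)
     (\<Sum>l<N. Polynomial.monom (sigma1 \<iota> t (inverse w ^ l)) (r * l))"

lemma emb_sigma1: "emb (sigma1 \<iota> t a) = (\<Sum>i<t. to_ac a ^ (q ^ i))"
proof -
  have "a ^ (CARD('a) ^ t) = a"
    using finite_field_power_card[of a] by (simp add: card_b q_def)
  from iota.h_sigma1[OF t_pos this] show ?thesis
    by (simp add: to_ac_sum q_def)
qed

text \<open>Expanding the trace and exchanging the sums gives, for each conjugate of \<open>w\<close>, a geometric sum over
  the powers of the \<open>N\<close>-th root of unity \<open>x^r / w^(q^u)\<close>; it is \<open>N\<close> or \<open>0\<close> according to whether
  this root of unity is \<open>1\<close>.\<close>

lemma ev_trace_poly:
  assumes N: "N > 0" "of_nat N \<noteq> (0::'a)" "w ^ N = 1" and x: "x ^ (r * N) = 1"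
  shows "ev (trace_poly N r w) x = of_nat (card {u\<in>{..<t}. x ^ r = to_ac w ^ (q ^ u)})"
proof -
  have N0: "of_nat N \<noteq> (0 :: 'b alg_closure)"
    using N(2) h_eq_0_iff[of "of_nat N"] by simp
  have W: "to_ac w ^ N = 1" "to_ac w \<noteq> 0"
    using N(1,3) by (auto simp: power_0_left simp flip: to_ac_power)
  let ?y = "\<lambda>u. x ^ r * inverse (to_ac w ^ (q ^ u))"
  have y: "?y u ^ N = 1" for u
  proof -
    have "(to_ac w ^ (q ^ u)) ^ N = (to_ac w ^ N) ^ (q ^ u)"
      by (simp only: mult.commute flip: power_mult)
    then show ?thesis
      using x by (simp add: power_mult_distrib power_inverse W(1) flip: power_mult)
  qed
  have "ev (trace_poly N r w) x
      = 1 / of_nat N * (\<Sum>l<N. (\<Sum>u<t. (inverse (to_ac w) ^ l) ^ (q ^ u)) * x ^ (r * l))"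
    by (simp add: trace_poly_def ev_sum emb_sigma1 divide_inverse)
  also have "(\<Sum>l<N. (\<Sum>u<t. (inverse (to_ac w) ^ l) ^ (q ^ u)) * x ^ (r * l))
      = (\<Sum>l<N. \<Sum>u<t. ?y u ^ l)"
    unfolding sum_distrib_right
  proof (intro sum.cong refl)
    fix l u
    have "(inverse (to_ac w) ^ l) ^ (q ^ u) = inverse (to_ac w ^ (q ^ u)) ^ l"
      by (simp only: power_inverse mult.commute flip: power_mult)
    then show "(inverse (to_ac w) ^ l) ^ (q ^ u) * x ^ (r * l) = ?y u ^ l"
      by (simp add: power_mult_distrib power_mult)
  qed
  also have "\<dots> = (\<Sum>u<t. \<Sum>l<N. ?y u ^ l)"
    by (rule sum.swap)
  also have "\<dots> = (\<Sum>u<t. if x ^ r = to_ac w ^ (q ^ u) then of_nat N else 0)"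
  proof (intro sum.cong refl)
    fix u
    have "?y u = 1 \<longleftrightarrow> x ^ r = to_ac w ^ (q ^ u)"
      using W(2) by (simp add: field_simps)
    then show "(\<Sum>l<N. ?y u ^ l) = (if x ^ r = to_ac w ^ (q ^ u) then of_nat N else 0)"
      by (simp only: sum_powers_root_of_unity[OF y])
  qed
  also have "\<dots> = of_nat N * of_nat (card {u\<in>{..<t}. x ^ r = to_ac w ^ (q ^ u)})"
    by (simp add: sum.If_cases Int_def mult.commute)
  finally show ?thesis
    using N0 by simp
qed

definition orbit_poly :: "nat \<Rightarrow> nat \<Rightarrow> 'a poly" where
  "orbit_poly e l = trace_poly (p ^ (k - e)) (p ^ e) (\<zeta> ^ l)"

text \<open>The divisibilities say that \<open>\<zeta>^l\<close> is different from \<open>1\<close> and is a \<open>p^(k-e)\<close>-th root of unity, so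
  that all its \<open>p^e\<close>-th roots are \<open>p^k\<close>-th roots of unity. For \<open>e > 0\<close> the order of \<open>\<zeta>^l\<close> has to be
  exactly \<open>p^m\<close>; for \<open>e = 0\<close> the map \<open>x \<mapsto> x^(p^e)\<close> is the identity and any order is permitted.\<close>

definition admissible :: "nat \<Rightarrow> nat \<Rightarrow> bool" where
  "admissible e l \<longleftrightarrow> e \<le> k \<and> \<not> p ^ m dvd l \<and> p ^ m dvd l * p ^ (k - e) \<and> (e = 0 \<or> \<not> p dvd l)"

lemma ev_orbit_poly:
  assumes "admissible e l" "x ^ (p ^ k) = 1"
  shows "ev (orbit_poly e l) x = (if x ^ (p ^ e) \<in> orb (Z ^ l) then 1 else 0)"
proof -
  let ?S = "{u\<in>{..<t}. x ^ (p ^ e) = (Z ^ l) ^ (q ^ u)}"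
  have "p ^ e * p ^ (k - e) = p ^ k"
    using assms(1) by (simp add: admissible_def flip: power_add)
  moreover have "(\<zeta> ^ l) ^ (p ^ (k - e)) = 1"
    using assms(1) primitive_root_of_unity_power_eq_1_iff[OF zeta] p_pos
    by (simp add: admissible_def flip: power_mult)
  ultimately have ev: "ev (orbit_poly e l) x = of_nat (card ?S)"
    using ev_trace_poly[of "p ^ (k - e)" "\<zeta> ^ l" x "p ^ e"] assms(2) p_pos of_nat_p_neq_0
    by (simp add: orbit_poly_def)
  have inj: "inj_on (\<lambda>u. (Z ^ l) ^ (q ^ u)) {..<t}"
    using assms(1) by (intro frobenius_inj) (simp_all add: Z_power_power Z_power_eq_1_iff admissible_def)
  show ?thesis
  proof (cases "x ^ (p ^ e) \<in> orb (Z ^ l)")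
    case True
    then obtain u where u: "u < t" "x ^ (p ^ e) = (Z ^ l) ^ (q ^ u)"
      by (auto simp: orb_eq_image[OF Z_power_power])
    then have "?S = {u}"
      using inj by (auto dest: inj_onD)
    with ev True show ?thesis by simp
  next
    case False
    then have "?S = {}"
      by (auto simp: orb_eq_image[OF Z_power_power])
    with ev False show ?thesis by (simp only: card.empty of_nat_0 if_False)
  qed
qed

lemma support_orbit_poly:
  assumes "admissible e l"
  shows "support (orbit_poly e l) = {x. x ^ (p ^ e) \<in> orb (Z ^ l)}"
proof -
  have "x ^ (p ^ k) = 1" if orb: "x ^ (p ^ e) \<in> orb (Z ^ l)" for x
  proof -
    obtain u where u: "x ^ (p ^ e) = (Z ^ l) ^ (q ^ u)"
      using orb by (auto simp: orb_def q_def)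
    have "p ^ k = p ^ e * p ^ (k - e)"
      using assms by (simp add: admissible_def flip: power_add)
    then have "x ^ (p ^ k) = (x ^ (p ^ e)) ^ (p ^ (k - e))"
      by (simp only: power_mult)
    also have "\<dots> = (Z ^ (l * p ^ (k - e))) ^ (q ^ u)"
      unfolding u by (simp only: mult.assoc mult.commute mult.left_commute flip: power_mult)
    also have "\<dots> = 1"
      using assms Z_power_eq_1_iff[of "l * p ^ (k - e)"] by (simp add: admissible_def)
    finally show ?thesis .
  qed
  then show ?thesis
    by (auto simp: support_def ev_orbit_poly[OF assms] split: if_splits)
qed

lemma root_exists: "\<exists>x. x ^ (p ^ e) = (y :: 'b alg_closure)"
  by (rule nth_root_exists) (simp add: p_pos)

text \<open>Given two points \<open>a\<close>, \<open>b\<close> of the support, some conjugate of \<open>a\<close> lies in the same fibre of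
  \<open>x \<mapsto> x^(p^e)\<close> as \<open>b\<close>, and the elements of one fibre are conjugate.\<close>

lemma orbit_indicator_orbit_poly:
  assumes "admissible e l"
  shows "orbit_indicator (orbit_poly e l)"
  unfolding orbit_indicator_def
proof (intro conjI ballI allI impI)
  show "ev (orbit_poly e l) x \<in> {0, 1}" if "x ^ (p ^ k) = 1" for x
    using that by (simp add: ev_orbit_poly[OF assms])
  obtain x where "x ^ (p ^ e) = Z ^ l"
    using root_exists by blast
  then show "support (orbit_poly e l) \<noteq> {}"
    using orb_self by (auto simp: support_orbit_poly[OF assms] intro!: exI[of _ x])
next
  fix a b
  assume "a \<in> support (orbit_poly e l)" "b \<in> support (orbit_poly e l)"
  then have ab: "a ^ (p ^ e) \<in> orb (Z ^ l)" "b ^ (p ^ e) \<in> orb (Z ^ l)"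
    by (simp_all add: support_orbit_poly[OF assms])
  have "b ^ (p ^ e) \<in> orb (a ^ (p ^ e))"
    using orb_trans[OF orb_sym[OF Z_power_power ab(1)] ab(2)] .
  then obtain u where u: "(a ^ (p ^ e)) ^ (q ^ u) = b ^ (p ^ e)"
    by (auto simp: orb_def q_def)
  have "b \<in> orb (a ^ (q ^ u))"
  proof (cases "e = 0")
    case True
    then show ?thesis using u orb_self by simp
  next
    case False
    obtain v where v: "b ^ (p ^ e) = Z ^ (l * q ^ v)"
      using ab(2) by (auto simp: orb_def q_def power_mult)
    show ?thesis
    proof (rule same_fibre_imp_mem_orb)
      show "(b ^ (p ^ e)) ^ (p ^ m) = 1"
        unfolding v by (rule Z_power_power)
      have "\<not> p dvd l * q ^ v"
        using False assms not_p_dvd_q prime_p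
        by (auto simp: admissible_def prime_dvd_mult_iff dest: prime_dvd_power)
      then have "\<not> p ^ (m - 1) * p dvd p ^ (m - 1) * (l * q ^ v)"
        using p_pos by simp
      moreover have "p ^ (m - 1) * p = p ^ m"
        using m_ge_1 by (simp flip: power_Suc2)
      ultimately have "\<not> p ^ m dvd (l * q ^ v) * p ^ (m - 1)"
        by (simp only: mult.commute not_False_eq_True)
      then show "(b ^ (p ^ e)) ^ (p ^ (m - 1)) \<noteq> 1"
        unfolding v by (simp only: Z_power_eq_1_iff not_False_eq_True flip: power_mult)
      show "(a ^ (q ^ u)) ^ (p ^ e) = b ^ (p ^ e)"
        unfolding u[symmetric] by (simp only: mult.commute flip: power_mult)
    qed simp
  qed
  moreover have "a ^ (q ^ u) \<in> orb a"
    by (auto simp: orb_def q_def)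
  ultimately show "b \<in> orb a"
    by (blast intro: orb_trans)
qed

lemma Z_power_mem_orb_iff: "Z ^ i \<in> orb (Z ^ j) \<longleftrightarrow> (\<exists>u. [i = j * q ^ u] (mod p ^ m))"
  by (auto simp: orb_def Z_power_eq_iff simp flip: power_mult q_def)

lemma cyc_class_orbit_poly_eq_iff:
  assumes "admissible e i" "admissible e j"
  shows "cyc_class (p ^ k) (orbit_poly e i) = cyc_class (p ^ k) (orbit_poly e j) \<longleftrightarrow>
    Z ^ i \<in> orb (Z ^ j)"
  unfolding orbit_indicator_cyc_class_eq_iff[OF assms[THEN orbit_indicator_orbit_poly]]
    support_orbit_poly[OF assms(1)] support_orbit_poly[OF assms(2)]
proof
  assume eq: "{x. x ^ (p ^ e) \<in> orb (Z ^ i)} = {x. x ^ (p ^ e) \<in> orb (Z ^ j)}"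
  obtain x where x: "x ^ (p ^ e) = Z ^ i"
    using root_exists by blast
  then have "x \<in> {x. x ^ (p ^ e) \<in> orb (Z ^ i)}"
    using orb_self by simp
  then have "x \<in> {x. x ^ (p ^ e) \<in> orb (Z ^ j)}"
    by (simp only: eq)
  with x show "Z ^ i \<in> orb (Z ^ j)" by simp
next
  assume "Z ^ i \<in> orb (Z ^ j)"
  moreover from this have "Z ^ j \<in> orb (Z ^ i)"
    by (rule orb_sym[OF Z_power_power])
  ultimately have "orb (Z ^ i) = orb (Z ^ j)"
    by (blast intro: orb_trans)
  then show "{x. x ^ (p ^ e) \<in> orb (Z ^ i)} = {x. x ^ (p ^ e) \<in> orb (Z ^ j)}" by simp
qed

lemma e1_eq: "e1 \<iota> t \<zeta> p k j = cyc_class (p ^ k) (orbit_poly 0 j)"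
proof -
  have "{0..p ^ k - 1} = {..<p ^ k}"
    using p_pos by (intro atLeast0AtMost_pred) simp
  moreover have "\<zeta> powi (- (int j * int l)) = inverse (\<zeta> ^ j) ^ l" for l
    by (simp add: power_int_minus power_inverse power_mult flip: of_nat_mult)
  ultimately show ?thesis
    by (simp add: e1_def orbit_poly_def trace_poly_def)
qed

lemma e2_eq:
  assumes "m < s" "s \<le> k"
  shows "e2 \<iota> t \<zeta> p k m s l = cyc_class (p ^ k) (orbit_poly (s - m) l)"
proof -
  have "k + m - s = k - (s - m)" "k - s + m = k - (s - m)"
    using assms by simp_all
  moreover have "{0..p ^ (k - (s - m)) - 1} = {..<p ^ (k - (s - m))}"
    using p_pos by (intro atLeast0AtMost_pred) simp
  moreover have "\<zeta> powi (- (int l * int j)) = inverse (\<zeta> ^ l) ^ j" for j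
    by (simp add: power_int_minus power_inverse power_mult flip: of_nat_mult)
  ultimately show ?thesis
    by (simp add: e2_def orbit_poly_def trace_poly_def)
qed

definition ones_poly :: "'a poly" where
  "ones_poly = Polynomial.smult (1 / of_nat (p ^ k)) (\<Sum>l<p ^ k. Polynomial.monom 1 l)"

lemma e0_eq: "e0 p k = cyc_class (p ^ k) ones_poly"
proof -
  have "{0..p ^ k - 1} = {..<p ^ k}"
    using p_pos by (intro atLeast0AtMost_pred) simp
  then show ?thesis by (simp add: e0_def ones_poly_def)
qed

lemma ev_ones_poly:
  assumes "x ^ (p ^ k) = 1"
  shows "ev ones_poly x = (if x = 1 then 1 else 0)"
proof -
  have "of_nat (p ^ k) \<noteq> (0 :: 'b alg_closure)"
    using of_nat_p_neq_0 h_eq_0_iff[of "of_nat (p ^ k)"] by simp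
  then show ?thesis
    using sum_powers_root_of_unity[OF assms]
    by (simp add: ones_poly_def ev_sum divide_inverse del: of_nat_power)
qed

lemma orbit_indicator_ones_poly: "orbit_indicator ones_poly"
  and support_ones_poly: "support ones_poly = {1}"
proof -
  show "support ones_poly = {1}"
    by (auto simp: support_def ev_ones_poly split: if_splits)
  then show "orbit_indicator ones_poly"
    by (simp add: orbit_indicator_def ev_ones_poly orb_self)
qed

section \<open>Classification and count\<close>

text \<open>The three cases are those of the theorem: the element \<open>1\<close>, the other elements of order at most
  \<open>p^m\<close>, and the elements of order \<open>p^s\<close> with \<open>s = m + e > m\<close>. For \<open>k < m\<close> the second case is met
  only by those \<open>l\<close> for which \<open>\<zeta>^l\<close> is a \<open>p^k\<close>-th root of unity.\<close>

lemma root_of_unity_cases: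
  assumes x: "x ^ (p ^ k) = 1"
  obtains "x = 1"
  | l where "0 < l" "l < p ^ m" "admissible 0 l" "x \<in> support (orbit_poly 0 l)"
  | e l where "0 < e" "m + e \<le> k" "0 < l" "l < p ^ m" "\<not> p dvd l" "admissible e l"
      "x \<in> support (orbit_poly e l)"
proof (cases "x ^ (p ^ m) = 1")
  case True
  then obtain j where j: "j < p ^ m" "x = Z ^ j"
    by (rule roots_of_unity_eq_powers)
  show thesis
  proof (cases "j = 0")
    case True
    with j that(1) show thesis by simp
  next
    case False
    have "p ^ m dvd j * p ^ k"
      using x by (simp only: j(2) Z_power_eq_1_iff flip: power_mult)
    moreover have "\<not> p ^ m dvd j"
      using j(1) False by (auto dest: dvd_imp_le)
    ultimately have adm: "admissible 0 j" by (simp add: admissible_def)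
    then have "x \<in> support (orbit_poly 0 j)"
      using orb_self by (simp add: support_orbit_poly j(2))
    with False j(1) adm that(2) show thesis by blast
  qed
next
  case False
  define s where "s = (LEAST s. x ^ (p ^ s) = 1)"
  have s: "x ^ (p ^ s) = 1" "s \<le> k"
    unfolding s_def using x by (auto intro: LeastI Least_le)
  have "m < s"
  proof (rule ccontr)
    assume "\<not> m < s"
    then have "p ^ m = p ^ s * p ^ (m - s)" by (simp flip: power_add)
    then have "x ^ (p ^ m) = 1" using s(1) by (simp only: power_mult power_one)
    with False show False ..
  qed
  have s': "x ^ (p ^ (s - 1)) \<noteq> 1"
    using \<open>m < s\<close> not_less_Least[of "s - 1" "\<lambda>s. x ^ (p ^ s) = 1"] by (simp add: s_def[symmetric])
  define e where "e = s - m"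
  have e: "0 < e" "m + e \<le> k" "s = e + m" "s - 1 = e + (m - 1)"
    using \<open>m < s\<close> s(2) m_ge_1 by (simp_all add: e_def)
  have "(x ^ (p ^ e)) ^ (p ^ m) = 1"
    using s(1) by (simp only: e(3) power_add power_mult)
  then obtain l where l: "l < p ^ m" "x ^ (p ^ e) = Z ^ l"
    by (rule roots_of_unity_eq_powers)
  have "\<not> p dvd l"
  proof
    assume "p dvd l"
    then obtain c where c: "l = p * c" ..
    have "l * p ^ (m - 1) = p ^ Suc (m - 1) * c" by (simp add: c)
    also have "Suc (m - 1) = m" using m_ge_1 by simp
    finally have "Z ^ (l * p ^ (m - 1)) = 1" by (simp add: Z_power_eq_1_iff)
    then have "x ^ (p ^ (s - 1)) = 1"
      by (simp only: e(4) power_add power_mult l(2))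
    with s' show False ..
  qed
  then have "l > 0" by (intro gr0I) simp
  have "\<not> p ^ m dvd l"
    using l(1) \<open>l > 0\<close> by (auto dest: dvd_imp_le)
  moreover have "p ^ m dvd l * p ^ (k - e)"
    using e(2) by (intro dvd_mult le_imp_power_dvd) simp
  ultimately have adm: "admissible e l"
    using e(2) \<open>\<not> p dvd l\<close> by (simp add: admissible_def)
  then have "x \<in> support (orbit_poly e l)"
    using orb_self by (simp add: support_orbit_poly l(2))
  with e(1,2) l(1) \<open>l > 0\<close> \<open>\<not> p dvd l\<close> adm that(3) show thesis by blast
qed

text \<open>The parameters with the same class as \<open>l\<close> are the exponents of the \<open>t\<close> conjugates of \<open>\<zeta>^l\<close>; so the
  map from parameters to classes has fibres of size \<open>t\<close>.\<close>

lemma card_orbit_classes: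
  assumes A: "A \<subseteq> {0<..<p ^ m}" "\<And>l. l \<in> A \<Longrightarrow> admissible e l"
    and closed: "\<And>l u. l \<in> A \<Longrightarrow> l * q ^ u mod p ^ m \<in> A"
  shows "real (card ((\<lambda>l. cyc_class (p ^ k) (orbit_poly e l)) ` A)) = real (card A) / real t"
proof -
  let ?F = "\<lambda>l. cyc_class (p ^ k) (orbit_poly e l)"
  have fin: "finite A" using A(1) by (rule finite_subset) simp
  have "card {i \<in> A. ?F i = ?F l} = t" if l: "l \<in> A" for l
  proof -
    have fibre: "{i \<in> A. ?F i = ?F l} = {i \<in> A. Z ^ i \<in> orb (Z ^ l)}"
      using cyc_class_orbit_poly_eq_iff[OF A(2) A(2)[OF l]] by blast
    have inj: "inj_on (\<lambda>i. Z ^ i) {i \<in> A. Z ^ i \<in> orb (Z ^ l)}"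
    proof (rule inj_onI)
      fix x y
      assume "x \<in> {i \<in> A. Z ^ i \<in> orb (Z ^ l)}" "y \<in> {i \<in> A. Z ^ i \<in> orb (Z ^ l)}" "Z ^ x = Z ^ y"
      then have "x < p ^ m" "y < p ^ m" "[x = y] (mod p ^ m)"
        using A(1) by (auto simp: Z_power_eq_iff)
      then show "x = y" by (simp add: cong_less_modulus_unique_nat)
    qed
    have image: "(\<lambda>i. Z ^ i) ` {i \<in> A. Z ^ i \<in> orb (Z ^ l)} = orb (Z ^ l)"
    proof (intro equalityI subsetI)
      fix y
      assume y: "y \<in> orb (Z ^ l)"
      then obtain u where "y = Z ^ (l * q ^ u)"
        by (auto simp: orb_def q_def power_mult)
      also have "\<dots> = Z ^ (l * q ^ u mod p ^ m)"
        by (simp add: Z_power_eq_iff cong_def)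
      finally show "y \<in> (\<lambda>i. Z ^ i) ` {i \<in> A. Z ^ i \<in> orb (Z ^ l)}"
        using y closed[OF l, of u] by blast
    qed auto
    have "card {i \<in> A. ?F i = ?F l} = card (orb (Z ^ l))"
      unfolding fibre using card_image[OF inj] by (simp only: image)
    also have "\<dots> = t"
      using A(2)[OF l] by (intro card_orb) (simp_all add: Z_power_power Z_power_eq_1_iff admissible_def)
    finally show ?thesis .
  qed
  then have "(\<Sum>c\<in>?F ` A. card {i \<in> A. ?F i = c}) = (\<Sum>c\<in>?F ` A. t)"
    by (intro sum.cong refl) auto
  then have "(\<Sum>c\<in>?F ` A. card {i \<in> A. ?F i = c}) = card (?F ` A) * t"
    by (simp only: sum_constant of_nat_id)
  moreover have "(\<Sum>c\<in>?F ` A. card {i \<in> A. ?F i = c}) = card A"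
    using sum.image_gen[OF fin, of "\<lambda>_. 1::nat" ?F] by (simp only: card_eq_sum)
  ultimately have "card A = card (?F ` A) * t" by (simp only:)
  then show ?thesis using t_pos by (simp only: of_nat_mult) simp
qed

text \<open>As \<open>q^t\<close> is \<open>1\<close> modulo \<open>p^m\<close>, the inverse of \<open>q\<close> is \<open>q^(t-1)\<close>, so negative exponents yield no
  new residues.\<close>

lemma int_power_mod_exponent_iff:
  "(\<exists>u::int. [int i = int j * int_power_mod (p ^ m) q u] (mod int (p ^ m))) \<longleftrightarrow>
   (\<exists>u::nat. [i = j * q ^ u] (mod p ^ m))"
proof
  assume "\<exists>u::nat. [i = j * q ^ u] (mod p ^ m)"
  then obtain u where "[i = j * q ^ u] (mod p ^ m)" ..
  then have "[int i = int j * int_power_mod (p ^ m) q (int u)] (mod int (p ^ m))"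
    by (simp add: int_power_mod_def flip: cong_int_iff)
  then show "\<exists>u::int. [int i = int j * int_power_mod (p ^ m) q u] (mod int (p ^ m))" ..
next
  assume "\<exists>u::int. [int i = int j * int_power_mod (p ^ m) q u] (mod int (p ^ m))"
  then obtain u :: int where u: "[int i = int j * int_power_mod (p ^ m) q u] (mod int (p ^ m))" ..
  obtain v where v: "[int_power_mod (p ^ m) q u = int (q ^ v)] (mod int (p ^ m))"
  proof (cases "u \<ge> 0")
    case True
    then show thesis using that[of "nat u"] by (simp add: int_power_mod_def)
  next
    case False
    let ?M = "int (p ^ m)" and ?r = "modular_inverse (int (p ^ m)) (int q)"
    have "coprime (int q) ?M"
      using coprime_p_q by (simp add: coprime_commute)
    then have inv: "[int q * ?r = 1] (mod ?M)" by (rule cong_modular_inverse1)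
    have "[int (q ^ t) = int 1] (mod ?M)"
      using cong_power_t[of 1] unfolding cong_int_iff by simp
    then have "[?r * int (q ^ t) = ?r * int 1] (mod ?M)"
      by (intro cong_mult cong_refl)
    moreover have "?r * int (q ^ t) = (int q * ?r) * int (q ^ (t - 1))"
    proof -
      have "int (q ^ t) = int q * int (q ^ (t - 1))"
        using t_pos by (simp flip: power_Suc)
      then show ?thesis by (simp only: mult.assoc mult.left_commute)
    qed
    moreover have "[(int q * ?r) * int (q ^ (t - 1)) = 1 * int (q ^ (t - 1))] (mod ?M)"
      using inv by (intro cong_mult cong_refl)
    ultimately have "[?r = int (q ^ (t - 1))] (mod ?M)"
      by (metis cong_sym cong_trans mult_1 mult.right_neutral of_nat_1)
    then have "[?r ^ nat (- u) = int (q ^ (t - 1)) ^ nat (- u)] (mod ?M)"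
      by (rule cong_pow)
    then show thesis
      using False that[of "(t - 1) * nat (- u)"] by (simp add: int_power_mod_def power_mult)
  qed
  have "[int i = int j * int (q ^ v)] (mod int (p ^ m))"
    using cong_trans[OF u cong_mult[OF cong_refl v]] .
  then have "[i = j * q ^ v] (mod p ^ m)"
    by (simp only: cong_int_iff flip: of_nat_mult)
  then show "\<exists>u::nat. [i = j * q ^ u] (mod p ^ m)" ..
qed

lemma admissible_0: "m \<le> k \<Longrightarrow> 0 < j \<Longrightarrow> j \<le> p ^ m - 1 \<Longrightarrow> admissible 0 j"
  using p_pos by (auto simp: admissible_def le_imp_power_dvd dest!: dvd_imp_le)

lemma admissible_positive_level:
  assumes "m < s" "s \<le> k" "gcd l p = 1"
  shows "admissible (s - m) l"
proof -
  have "\<not> p dvd l"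
    using assms(3) prime_p by (metis gcd_nat.absorb2 not_prime_1)
  moreover have "p dvd p ^ m"
    using m_ge_1 by (intro dvd_power) simp
  ultimately have "\<not> p ^ m dvd l"
    using dvd_trans by blast
  moreover have "p ^ m dvd l * p ^ (k - (s - m))"
    using assms(1,2) by (intro dvd_mult le_imp_power_dvd) simp
  ultimately show ?thesis
    using \<open>\<not> p dvd l\<close> assms(2) by (simp add: admissible_def)
qed

end

theorem theorem5p1:
  fixes \<iota> :: "'a::{field,finite} \<Rightarrow> 'b::{field,finite}"
    and \<zeta> :: 'b
    and q k p t m :: nat
  assumes "q = CARD('a)"
    and "k > 0"
    and "Factorial_Ring.prime p" and "odd p"
    and "ord p q = t" and "t > 1"
    and "m \<ge> 1" and "p ^ m dvd q ^ t - 1" and "\<not> p ^ (m + 1) dvd q ^ t - 1"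
    and "CARD('b) = q ^ t"
    and "\<iota> \<in> ring_hom ring_of_type_algebra ring_of_type_algebra"
    and "primitive_root_of_unity (p ^ m) \<zeta>"
  shows
    "{e :: 'a poly set. primitive_idempotent (cyc_ring (p ^ k)) e} \<subseteq>
       {e0 p k}
       \<union> {e1 \<iota> t \<zeta> p k j | j. 0 < j \<and> j \<le> p ^ m - 1}
       \<union> {e2 \<iota> t \<zeta> p k m s l | s l. m < s \<and> s \<le> k \<and> 0 < l \<and> l < p ^ m \<and> gcd l p = 1}
     \<and> primitive_idempotent (cyc_ring (p ^ k)) (e0 p k :: 'a poly set)
     \<and> (m \<le> k \<longrightarrow>
          (\<forall>j. 0 < j \<and> j \<le> p ^ m - 1 \<longrightarrow>
             primitive_idempotent (cyc_ring (p ^ k)) (e1 \<iota> t \<zeta> p k j)) \<and>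
          (\<forall>i j. 0 < i \<and> i \<le> p ^ m - 1 \<and> 0 < j \<and> j \<le> p ^ m - 1 \<longrightarrow>
             (e1 \<iota> t \<zeta> p k i = e1 \<iota> t \<zeta> p k j \<longleftrightarrow>
              (\<exists>u::int. [int i = int j * int_power_mod (p ^ m) q u] (mod int (p ^ m))))) \<and>
          real (card {e1 \<iota> t \<zeta> p k j | j. 0 < j \<and> j \<le> p ^ m - 1})
            = real (p ^ m - 1) / real t)
     \<and> (\<forall>s. m < s \<and> s \<le> k \<longrightarrow>
          (\<forall>l. 0 < l \<and> l < p ^ m \<and> gcd l p = 1 \<longrightarrow>
             primitive_idempotent (cyc_ring (p ^ k)) (e2 \<iota> t \<zeta> p k m s l)) \<and>
          (\<forall>l1 l2. 0 < l1 \<and> l1 < p ^ m \<and> gcd l1 p = 1 \<and>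
                   0 < l2 \<and> l2 < p ^ m \<and> gcd l2 p = 1 \<longrightarrow>
             (e2 \<iota> t \<zeta> p k m s l1 = e2 \<iota> t \<zeta> p k m s l2 \<longleftrightarrow>
              (\<exists>u::nat. [l1 = l2 * q ^ u] (mod p ^ m)))) \<and>
          real (card {e2 \<iota> t \<zeta> p k m s l | l. 0 < l \<and> l < p ^ m \<and> gcd l p = 1})
            = real (totient (p ^ m)) / real t)"
proof -
  interpret cyclic_prime_power_length \<iota> \<zeta> q k p t m
    by unfold_locales (fact assms)+
  let ?R = "cyc_ring (p ^ k) :: 'a poly set ring"
  have gcd_iff: "gcd l p = 1 \<longleftrightarrow> \<not> p dvd l" for l
    using prime_p by (metis coprime_commute coprime_iff_gcd_eq_1 gcd_nat.absorb2 not_prime_1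
        prime_imp_coprime)
  show ?thesis
  proof (intro conjI impI allI subsetI)
    fix e :: "'a poly set"
    assume "e \<in> {e. primitive_idempotent ?R e}"
    then obtain f where f: "e = cyc_class (p ^ k) f" "primitive_idempotent ?R (cyc_class (p ^ k) f)"
      by (auto simp: primitive_idempotent_def idempotent_elem_def carrier_cyc_ring)
    \<comment> \<open>A nonzero idempotent has a point \<open>x\<close> in its support; the listed idempotent whose support
        contains \<open>x\<close> is equal to it.\<close>
    then obtain x where x: "x ^ (p ^ k) = 1" "x \<in> support f"
      by (auto simp: primitive_idempotent_def cyc_class_eq_zero_iff support_def)
    have same: "e = cyc_class (p ^ k) g" if "orbit_indicator g" "x \<in> support g" for g
      unfolding f(1) using f(2) that x(2) by (intro primitive_idempotent_eq_orbit_indicator)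
    from x(1) show "e \<in> {e0 p k}
       \<union> {e1 \<iota> t \<zeta> p k j | j. 0 < j \<and> j \<le> p ^ m - 1}
       \<union> {e2 \<iota> t \<zeta> p k m s l | s l. m < s \<and> s \<le> k \<and> 0 < l \<and> l < p ^ m \<and> gcd l p = 1}"
    proof (cases rule: root_of_unity_cases)
      case 1
      then have "e = e0 p k"
        using same[OF orbit_indicator_ones_poly] by (simp add: support_ones_poly e0_eq)
      then show ?thesis by blast
    next
      case (2 l)
      then have "e = e1 \<iota> t \<zeta> p k l"
        using same[OF orbit_indicator_orbit_poly] by (simp add: e1_eq)
      moreover have "l \<le> p ^ m - 1"
        using 2 by simp
      ultimately show ?thesis using 2 by blast
    next
      case (3 d l)
      then have "e = e2 \<iota> t \<zeta> p k m (m + d) l"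
        using same[OF orbit_indicator_orbit_poly] by (simp add: e2_eq)
      moreover have "m < m + d" "gcd l p = 1"
        using 3 by (simp_all only: gcd_iff) simp
      ultimately show ?thesis
        using 3 by (intro UnI2 CollectI exI[of _ "m + d"] exI[of _ l] conjI)
    qed
  next
    show "primitive_idempotent ?R (e0 p k)"
      unfolding e0_eq by (rule primitive_idempotent_orbit_indicator[OF orbit_indicator_ones_poly])
  next
    fix j
    assume "m \<le> k" "0 < j \<and> j \<le> p ^ m - 1"
    then show "primitive_idempotent ?R (e1 \<iota> t \<zeta> p k j)"
      unfolding e1_eq
      by (intro primitive_idempotent_orbit_indicator orbit_indicator_orbit_poly admissible_0) auto
  next
    fix i j
    assume "m \<le> k" "0 < i \<and> i \<le> p ^ m - 1 \<and> 0 < j \<and> j \<le> p ^ m - 1"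
    then show "e1 \<iota> t \<zeta> p k i = e1 \<iota> t \<zeta> p k j \<longleftrightarrow>
        (\<exists>u::int. [int i = int j * int_power_mod (p ^ m) q u] (mod int (p ^ m)))"
      unfolding int_power_mod_exponent_iff e1_eq Z_power_mem_orb_iff[symmetric]
      by (intro cyc_class_orbit_poly_eq_iff admissible_0) auto
  next
    assume "m \<le> k"
    let ?A = "{0<..<p ^ m}"
    have set: "{e1 \<iota> t \<zeta> p k j | j. 0 < j \<and> j \<le> p ^ m - 1}
        = (\<lambda>j. cyc_class (p ^ k) (orbit_poly 0 j)) ` ?A"
    proof -
      have "{j. 0 < j \<and> j \<le> p ^ m - 1} = ?A" using p_pos by auto
      then show ?thesis by (simp only: e1_eq setcompr_eq_image)
    qed
    have "real (card ((\<lambda>j. cyc_class (p ^ k) (orbit_poly 0 j)) ` ?A)) = real (card ?A) / real t"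
    proof (rule card_orbit_classes)
      show "admissible 0 l" if "l \<in> ?A" for l
        using \<open>m \<le> k\<close> that by (intro admissible_0) auto
      fix l u
      assume l: "l \<in> ?A"
      have "coprime (p ^ m) (q ^ u)"
        using coprime_p_q by simp
      moreover have "\<not> p ^ m dvd l"
        using l by (auto dest: dvd_imp_le)
      ultimately have "\<not> p ^ m dvd l * q ^ u"
        by (simp only: coprime_dvd_mult_left_iff not_False_eq_True)
      then show "l * q ^ u mod p ^ m \<in> ?A"
        using p_pos by (simp add: dvd_eq_mod_eq_0)
    qed simp
    then show "real (card {e1 \<iota> t \<zeta> p k j | j. 0 < j \<and> j \<le> p ^ m - 1}) = real (p ^ m - 1) / real t"
      unfolding set by simp
  next
    fix s l
    assume "m < s \<and> s \<le> k" "0 < l \<and> l < p ^ m \<and> gcd l p = 1"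
    then show "primitive_idempotent ?R (e2 \<iota> t \<zeta> p k m s l)"
      by (simp add: e2_eq primitive_idempotent_orbit_indicator orbit_indicator_orbit_poly
          admissible_positive_level)
  next
    fix s l1 l2
    assume s: "m < s \<and> s \<le> k"
      and l: "0 < l1 \<and> l1 < p ^ m \<and> gcd l1 p = 1 \<and> 0 < l2 \<and> l2 < p ^ m \<and> gcd l2 p = 1"
    have "admissible (s - m) l1" "admissible (s - m) l2"
      using s l by (simp_all only: admissible_positive_level)
    then show "e2 \<iota> t \<zeta> p k m s l1 = e2 \<iota> t \<zeta> p k m s l2 \<longleftrightarrow> (\<exists>u::nat. [l1 = l2 * q ^ u] (mod p ^ m))"
      using s by (simp only: e2_eq cyc_class_orbit_poly_eq_iff Z_power_mem_orb_iff)
  next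
    fix s
    assume s: "m < s \<and> s \<le> k"
    let ?A = "{l. 0 < l \<and> l < p ^ m \<and> gcd l p = 1}"
    have set: "{e2 \<iota> t \<zeta> p k m s l | l. 0 < l \<and> l < p ^ m \<and> gcd l p = 1}
        = (\<lambda>l. cyc_class (p ^ k) (orbit_poly (s - m) l)) ` ?A"
      using s by (simp only: e2_eq setcompr_eq_image)
    have pdvd: "p dvd p ^ m"
      using m_ge_1 by (intro dvd_power) simp
    have "real (card ((\<lambda>l. cyc_class (p ^ k) (orbit_poly (s - m) l)) ` ?A)) = real (card ?A) / real t"
    proof (rule card_orbit_classes)
      show "admissible (s - m) l" if "l \<in> ?A" for l
        using s that by (intro admissible_positive_level) auto
      fix l u
      assume l: "l \<in> ?A"
      then have "\<not> p dvd l * q ^ u"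
        using not_p_dvd_q prime_p
        by (auto simp: gcd_iff[unfolded One_nat_def] prime_dvd_mult_iff dest: prime_dvd_power)
      then have ndvd: "\<not> p dvd l * q ^ u mod p ^ m"
        using dvd_mod_iff[OF pdvd] by blast
      then have "l * q ^ u mod p ^ m \<noteq> 0"
        by (metis dvd_0_right)
      with ndvd show "l * q ^ u mod p ^ m \<in> ?A"
        using p_pos by (simp only: gcd_iff mem_Collect_eq) simp
    qed auto
    moreover have "?A = totatives (p ^ m)"
    proof (intro equalityI subsetI)
      fix l
      assume "l \<in> totatives (p ^ m)"
      then have l: "0 < l" "l \<le> p ^ m" "coprime l (p ^ m)"
        by (simp_all add: totatives_def)
      then have "coprime l p"
        using m_ge_1 by simp
      then have "gcd l p = 1"
        by (simp only: coprime_iff_gcd_eq_1)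
      then have "l \<noteq> p ^ m"
        using pdvd gcd_iff[of l] by metis
      with l(1,2) \<open>gcd l p = 1\<close> show "l \<in> ?A"
        by simp
    next
      fix l
      assume "l \<in> ?A"
      then have l: "0 < l" "l < p ^ m" "gcd l p = 1" by simp_all
      then have "coprime l p"
        by (simp only: coprime_iff_gcd_eq_1)
      with l(1,2) show "l \<in> totatives (p ^ m)"
        by (simp add: totatives_def)
    qed
    ultimately show "real (card {e2 \<iota> t \<zeta> p k m s l | l. 0 < l \<and> l < p ^ m \<and> gcd l p = 1})
        = real (totient (p ^ m)) / real t"
      unfolding set totient_def by simp
  qed
qed

end
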